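(* Let $K(n,d)$ be the supremum, over all initial conditions (positions and velocities), of the number of elastic collisions of $n$ balls of equal radii and equal masses in $\mathbb{R}^d$. For all integers $n\ge 3$ and $d\ge 2$, $$K(n,d)>\frac{n(n-1)}{2}.$$
   Context: Dynamics. Consider $n$ balls in $\mathbb{R}^d$, all of radius 1 and identical masses, with pairwise disjoint interiors at all times, evolving over all times $t\in(-\infty,\infty)$. Each ball moves with constant velocity between collisions. If two balls with centers $x(t),y(t)$ touch at time $t$ (i.e. $|x(t)-y(t)|=2$), no other ball touches either of them at time $t$, and the velocities just before satisfy $(Dx(t-)-Dy(t-))\cdot(x(t)-y(t))<0$, then with $\mathbf{x}=x(t)-y(t)$ and $P_w z=(z\cdot w)w/|w|^2$ the velocities just after are $$Dx(t)=Dx(t-)-P_{\mathbf{x}}(D(x-y)(t-)),\qquad Dy(t)=Dy(t-)-P_{\mathbf{x}}(D(y-x)(t-)).$$ Here $D$ denotes the right derivative in time and $t-$ a left limit. A simultaneous collision at time $t$ means that some collection of at least 3 balls is connected via contacts (tangencies) at time $t$. Only evolutions without simultaneous collisions are considered (contacts of disjoint pairs of balls at the same time are allowed). Collisions. A collision of two balls at a space-time point $(y,t)$ is counted if and only if: (i) the two balls are tangent at $y$ at time $t$; (ii) for some $\varepsilon>0$ the two balls do not touch during $(t-\varepsilon,t)$ and $(t,t+\varepsilon)$; (iii) both balls change velocity at time $t$. (In particular grazing contacts are not counted.) $K(n,d)$ is the supremum of the total number of collisions during $(-\infty,\infty)$ over all such evolutions. *)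

theory Defs
  imports "HOL-Analysis.Analysis" "HOL-Library.Extended_Nat"
begin

text \<open>
  Throughout, \<open>x i t\<close> is the centre at time \<open>t\<close> of ball \<open>i\<close>, for \<open>i < n\<close>; all balls have radius 1.
  Values \<open>x i\<close> with \<open>i \<ge> n\<close> are irrelevant.
\<close>

text \<open>The right derivative \<open>Dp(t)\<close> and its left limit \<open>Dp(t-)\<close>.  These are meaningful only where they
  exist; existence is part of \<open>evolution\<close> below.\<close>

definition velocity :: "(real \<Rightarrow> 'a::euclidean_space) \<Rightarrow> real \<Rightarrow> 'a" where
  "velocity p t = vector_derivative p (at_right t)"

definition velocity_before :: "(real \<Rightarrow> 'a::euclidean_space) \<Rightarrow> real \<Rightarrow> 'a" where
  "velocity_before p t = Lim (at_left t) (velocity p)"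

definition proj :: "'a::euclidean_space \<Rightarrow> 'a \<Rightarrow> 'a" where
  "proj w z = ((z \<bullet> w) / (norm w)\<^sup>2) *\<^sub>R w"

definition touching :: "(nat \<Rightarrow> real \<Rightarrow> 'a::euclidean_space) \<Rightarrow> nat \<Rightarrow> nat \<Rightarrow> real \<Rightarrow> bool" where
  "touching x i j t \<longleftrightarrow> norm (x i t - x j t) = 2"

text \<open>The event that triggers a change of velocities.\<close>

definition impact ::
    "nat \<Rightarrow> (nat \<Rightarrow> real \<Rightarrow> 'a::euclidean_space) \<Rightarrow> nat \<Rightarrow> nat \<Rightarrow> real \<Rightarrow> bool" where
  "impact n x i j t \<longleftrightarrow>
     touching x i j t \<and>
     (\<forall>k<n. k \<noteq> i \<and> k \<noteq> j \<longrightarrow> \<not> touching x i k t \<and> \<not> touching x j k t) \<and>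
     (velocity_before (x i) t - velocity_before (x j) t) \<bullet> (x i t - x j t) < 0"

definition contacts :: "nat \<Rightarrow> (nat \<Rightarrow> real \<Rightarrow> 'a::euclidean_space) \<Rightarrow> real \<Rightarrow> (nat \<times> nat) set" where
  "contacts n x t = {(i, j). i < n \<and> j < n \<and> touching x i j t}"

definition simultaneous_collision ::
    "nat \<Rightarrow> (nat \<Rightarrow> real \<Rightarrow> 'a::euclidean_space) \<Rightarrow> real \<Rightarrow> bool" where
  "simultaneous_collision n x t \<longleftrightarrow>
     (\<exists>S \<subseteq> {..<n}. card S \<ge> 3 \<and> (\<forall>i\<in>S. \<forall>j\<in>S. (i, j) \<in> (contacts n x t \<inter> S \<times> S)\<^sup>*))"

text \<open>In the clause on free motion the word \<^emph>\<open>collision\<close> has to mean \<open>impact\<close>: at any other contact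
  (grazing, or balls moving along while touching) velocities do not change.\<close>

definition evolution :: "nat \<Rightarrow> (nat \<Rightarrow> real \<Rightarrow> 'a::euclidean_space) \<Rightarrow> bool" where
  "evolution n x \<longleftrightarrow>
     (\<forall>i<n. continuous_on UNIV (x i)) \<and>
     (\<forall>i<n. \<forall>t. x i differentiable (at_right t)) \<and>
     (\<forall>i<n. \<forall>t. \<exists>v. (velocity (x i) \<longlongrightarrow> v) (at_left t)) \<and>
     (\<forall>t. \<forall>i<n. \<forall>j<n. i \<noteq> j \<longrightarrow> ball (x i t) 1 \<inter> ball (x j t) 1 = {}) \<and>
     (\<forall>t. \<not> simultaneous_collision n x t) \<and>
     (\<forall>i<n. \<forall>a b. (\<forall>t\<in>{a<..<b}. \<forall>j<n. \<not> impact n x i j t) \<longrightarrow>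
        velocity (x i) constant_on {a<..<b}) \<and>
     (\<forall>t. \<forall>i<n. \<forall>j<n. impact n x i j t \<longrightarrow>
        velocity (x i) t = velocity_before (x i) t -
          proj (x i t - x j t) (velocity_before (x i) t - velocity_before (x j) t) \<and>
        velocity (x j) t = velocity_before (x j) t -
          proj (x i t - x j t) (velocity_before (x j) t - velocity_before (x i) t))"

text \<open>The counted collisions.  An element \<open>(i, j, y, t)\<close> is a collision of balls \<open>i\<close> and \<open>j\<close> at the
  space-time point \<open>(y, t)\<close>; requiring \<open>i < j\<close> counts each unordered pair once.  Two balls of
  radius 1 whose centres have distance 2 are tangent precisely at the midpoint of the centres.\<close>

definition collisions ::
    "nat \<Rightarrow> (nat \<Rightarrow> real \<Rightarrow> 'a::euclidean_space) \<Rightarrow> (nat \<times> nat \<times> 'a \<times> real) set" where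
  "collisions n x = {(i, j, y, t). i < j \<and> j < n \<and>
     touching x i j t \<and> y = midpoint (x i t) (x j t) \<and>
     (\<exists>\<epsilon>>0. \<forall>s \<in> {t - \<epsilon><..<t} \<union> {t<..<t + \<epsilon>}. \<not> touching x i j s) \<and>
     velocity (x i) t \<noteq> velocity_before (x i) t \<and>
     velocity (x j) t \<noteq> velocity_before (x j) t}"

definition ecard :: "'a set \<Rightarrow> enat" where
  "ecard A = (if finite A then enat (card A) else \<infinity>)"

text \<open>\<open>K n TYPE('d)\<close> is \<open>K(n,d)\<close> for \<open>d = CARD('d)\<close>.\<close>

definition K :: "nat \<Rightarrow> 'd::finite itself \<Rightarrow> enat" where
  "K n T = (SUP x \<in> {x :: nat \<Rightarrow> real \<Rightarrow> real ^ 'd. evolution n x}. ecard (collisions n x))"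

end

theory Submission
  imports Defs
begin

text \<open>
  Three balls in the plane can collide four times, and the parameters can be tuned so that the velocities
  after the fourth collision are parallel and distinct.  Long afterwards, in a scale in which the balls
  are tiny, such balls look like points moving apart on a line.  If \<open>n\<close> balls are in such a state, a fast
  ball sent along the line from behind starts a relay: it hits the rearmost ball, which takes over its
  speed and hits the next one, and so on, which gives \<open>n\<close> further collisions.  The balls do not lie exactly
  on a line, so the relay has to be aimed: the times and the directions of the impacts are computed
  backwards from the last one, each being the solution of a linear equation.  In the limit of tiny balls
  the relay is the exchange of velocities of points on a line, so that afterwards \<open>n + 1\<close> balls are in a state of
  the same kind.  Induction from \<open>4\<close> collisions of \<open>3\<close> balls gives \<open>n (n - 1) / 2 + 1\<close> collisions.
\<close>

section \<open>Motions up to a given time\<close>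

text \<open>Points of equal mass on a line exchange velocities, so each pair of their world lines
  crosses at most once and \<open>n\<close> points collide at most n(n-1)/2 times. The surplus of
  one must come from a genuinely planar configuration; since 4 = 3 * 2 / 2 + 1, three balls supply
  it. A relay adds \<open>n\<close> collisions, which is exactly the difference between the bounds
  for n + 1 and for n, so the surplus survives the induction. Aiming forwards would be unstable: an
  error of the size of a diameter changes the direction of impact by a fixed angle. Backwards
  nothing is amplified. Once the time, the direction and the transferred speed of the next impact
  are prescribed, the time of the current one solves a linear equation whose leading coefficient
  tends to the positive number \<open>U - A m\<close>, and its direction is the normalised change of
  velocity that is required. Hence all data converge to those of points on the line, and strict
  inequalities between the points pass to sufficiently small balls. A ball added late must not have
  disturbed the earlier collisions. For this reason a bound on all past speeds is carried along in
  \<open>reach\<close>.\<close>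

definition kink :: "(real \<Rightarrow> 'a::euclidean_space) \<Rightarrow> real \<Rightarrow> 'a \<Rightarrow> 'a \<Rightarrow> bool" where
  "kink p t b a \<longleftrightarrow> (\<exists>e>0. (\<forall>s. t - e \<le> s \<longrightarrow> s \<le> t \<longrightarrow> p s = p t + (s - t) *\<^sub>R b) \<and>
                           (\<forall>s. t \<le> s \<longrightarrow> s \<le> t + e \<longrightarrow> p s = p t + (s - t) *\<^sub>R a))"

definition collide :: "'a::euclidean_space \<Rightarrow> nat \<Rightarrow> nat \<Rightarrow> (nat \<Rightarrow> 'a) \<Rightarrow> nat \<Rightarrow> 'a" where
  "collide w i j b k = (if k = i then b i - proj w (b i - b j)
                        else if k = j then b j - proj w (b j - b i) else b k)"

definition apart :: "real \<Rightarrow> nat \<Rightarrow> (nat \<Rightarrow> 'a::euclidean_space) \<Rightarrow> bool" where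
  "apart \<delta> n q \<longleftrightarrow> (\<forall>k<n. \<forall>l<n. k \<noteq> l \<longrightarrow> \<delta> < norm (q k - q l))"

definition apart_except :: "real \<Rightarrow> nat \<Rightarrow> nat \<Rightarrow> nat \<Rightarrow> (nat \<Rightarrow> 'a::euclidean_space) \<Rightarrow> bool" where
  "apart_except \<delta> n i j q \<longleftrightarrow>
     (\<forall>k<n. \<forall>l<n. k \<noteq> l \<longrightarrow> {k, l} \<noteq> {i, j} \<longrightarrow> \<delta> < norm (q k - q l))"

text \<open>At most one pair touches at any time, and it touches while strictly approaching. This is
  stricter than an evolution has to be: there are no grazing contacts, and a contact time determines
  its collision, so that collisions can be counted by their times.\<close>

definition lawful :: "real \<Rightarrow> nat \<Rightarrow> (nat \<Rightarrow> real \<Rightarrow> 'a::euclidean_space) \<Rightarrow> real \<Rightarrow> bool" where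
  "lawful \<delta> n x t \<longleftrightarrow> (\<exists>b a. (\<forall>i<n. kink (x i) t (b i) (a i)) \<and>
     (apart \<delta> n (\<lambda>i. x i t) \<and> (\<forall>i<n. a i = b i) \<or>
      (\<exists>i<n. \<exists>j<n. i \<noteq> j \<and> norm (x i t - x j t) = \<delta> \<and> (b i - b j) \<bullet> (x i t - x j t) < 0 \<and>
         apart_except \<delta> n i j (\<lambda>i. x i t) \<and> (\<forall>k<n. a k = collide (x i t - x j t) i j b k))))"

lemma lawful_freeI:
  assumes "\<And>i. i < n \<Longrightarrow> kink (x i) t (b i) (b i)" "apart \<delta> n (\<lambda>i. x i t)"
  shows "lawful \<delta> n x t"
  unfolding lawful_def using assms by blast

lemma lawful_hitI:
  assumes "\<And>k. k < n \<Longrightarrow> kink (x k) t (b k) (a k)" "i < n" "j < n" "i \<noteq> j"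
    and "norm (x i t - x j t) = \<delta>" "(b i - b j) \<bullet> (x i t - x j t) < 0"
    and "apart_except \<delta> n i j (\<lambda>i. x i t)" "\<And>k. k < n \<Longrightarrow> a k = collide (x i t - x j t) i j b k"
  shows "lawful \<delta> n x t"
  unfolding lawful_def using assms by blast

lemma lawfulE:
  assumes "lawful \<delta> n x t"
  obtains (free) b where "\<And>i. i < n \<Longrightarrow> kink (x i) t (b i) (b i)" "apart \<delta> n (\<lambda>i. x i t)"
  | (hit) b a i j where "\<And>k. k < n \<Longrightarrow> kink (x k) t (b k) (a k)" "i < n" "j < n" "i \<noteq> j"
      "norm (x i t - x j t) = \<delta>" "(b i - b j) \<bullet> (x i t - x j t) < 0"
      "apart_except \<delta> n i j (\<lambda>i. x i t)" "\<And>k. k < n \<Longrightarrow> a k = collide (x i t - x j t) i j b k"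
proof -
  obtain b a where k: "\<forall>i<n. kink (x i) t (b i) (a i)"
    and "apart \<delta> n (\<lambda>i. x i t) \<and> (\<forall>i<n. a i = b i) \<or>
      (\<exists>i<n. \<exists>j<n. i \<noteq> j \<and> norm (x i t - x j t) = \<delta> \<and> (b i - b j) \<bullet> (x i t - x j t) < 0 \<and>
         apart_except \<delta> n i j (\<lambda>i. x i t) \<and> (\<forall>k<n. a k = collide (x i t - x j t) i j b k))"
    using assms unfolding lawful_def by blast
  then show thesis
  proof (elim disjE)
    assume "apart \<delta> n (\<lambda>i. x i t) \<and> (\<forall>i<n. a i = b i)"
    then show thesis
      using k by (intro free[of b]) auto
  qed (use k hit[of b a] in blast)
qed

definition contact_times :: "real \<Rightarrow> nat \<Rightarrow> (nat \<Rightarrow> real \<Rightarrow> 'a::euclidean_space) \<Rightarrow> real set" where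
  "contact_times \<delta> n x = {t. \<exists>i<n. \<exists>j<n. i \<noteq> j \<and> norm (x i t - x j t) = \<delta>}"

text \<open>\<open>reach \<delta> n N V T p v\<close>: some motion of balls of diameter \<open>\<delta>\<close> obeys the laws up to time \<open>T\<close>,
  has \<open>N\<close> collisions by then and speeds at most \<open>V\<close>, and is given from slightly before \<open>T\<close> on by
  the lines \<open>p i + t v i\<close>, on which balls may overlap after time \<open>T\<close>.\<close>

definition reach ::
    "real \<Rightarrow> nat \<Rightarrow> nat \<Rightarrow> real \<Rightarrow> real \<Rightarrow> (nat \<Rightarrow> 'a::euclidean_space) \<Rightarrow> (nat \<Rightarrow> 'a) \<Rightarrow> bool" where
  "reach \<delta> n N V T p v \<longleftrightarrow> (\<exists>x.
     (\<forall>t\<le>T. lawful \<delta> n x t) \<and>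
     (\<exists>T'<T. \<forall>i<n. \<forall>t\<ge>T'. x i t = p i + t *\<^sub>R v i) \<and>
     (\<forall>i<n. \<forall>s t. norm (x i s - x i t) \<le> V * \<bar>s - t\<bar>) \<and>
     (\<exists>C. finite C \<and> card C = N \<and> C \<subseteq> {..T} \<and> C \<subseteq> contact_times \<delta> n x))"

lemma reachI:
  assumes "\<And>t. t \<le> T \<Longrightarrow> lawful \<delta> n x t" "U < T"
    "\<And>k t. k < n \<Longrightarrow> U \<le> t \<Longrightarrow> x k t = p k + t *\<^sub>R v k"
    "\<And>k s t. k < n \<Longrightarrow> norm (x k s - x k t) \<le> V * \<bar>s - t\<bar>"
    "finite C" "card C = N" "C \<subseteq> {..T}" "C \<subseteq> contact_times \<delta> n x"
  shows "reach \<delta> n N V T p v"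
  unfolding reach_def
proof (intro exI[of _ x] conjI)
  show "\<exists>T'<T. \<forall>i<n. \<forall>t\<ge>T'. x i t = p i + t *\<^sub>R v i"
    using assms(2,3) by blast
  show "\<exists>C. finite C \<and> card C = N \<and> C \<subseteq> {..T} \<and> C \<subseteq> contact_times \<delta> n x"
    using assms(5-) by blast
qed (use assms(1,4) in blast)+

lemma reachE:
  assumes "reach \<delta> n N V T p v"
  obtains x U C where "\<And>t. t \<le> T \<Longrightarrow> lawful \<delta> n x t" "U < T"
    "\<And>k t. k < n \<Longrightarrow> U \<le> t \<Longrightarrow> x k t = p k + t *\<^sub>R v k"
    "\<And>k s t. k < n \<Longrightarrow> norm (x k s - x k t) \<le> V * \<bar>s - t\<bar>"
    "finite C" "card C = N" "C \<subseteq> {..T}" "C \<subseteq> contact_times \<delta> n x"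
proof -
  obtain x where x: "(\<forall>t\<le>T. lawful \<delta> n x t) \<and> (\<exists>T'<T. \<forall>i<n. \<forall>t\<ge>T'. x i t = p i + t *\<^sub>R v i) \<and>
     (\<forall>i<n. \<forall>s t. norm (x i s - x i t) \<le> V * \<bar>s - t\<bar>) \<and>
     (\<exists>C. finite C \<and> card C = N \<and> C \<subseteq> {..T} \<and> C \<subseteq> contact_times \<delta> n x)"
    using assms unfolding reach_def by (elim exE)
  from x obtain U where U: "U < T" "\<forall>i<n. \<forall>t\<ge>U. x i t = p i + t *\<^sub>R v i"
    by (elim exE conjE)
  from x obtain C where C: "finite C" "card C = N" "C \<subseteq> {..T}" "C \<subseteq> contact_times \<delta> n x"
    by (elim exE conjE)
  show thesis
    by (rule that[of x U C]) (use x U C in simp_all)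
qed

lemma proj_minus_left [simp]: "proj (- w) z = proj w z"
  by (simp add: proj_def)

lemma inner_proj: "w \<noteq> 0 \<Longrightarrow> proj w z \<bullet> w = z \<bullet> w"
  by (simp add: proj_def power2_norm_eq_inner)

lemma proj_minus: "proj w (- z) = - proj w z"
  by (simp add: proj_def)

lemma proj_swap: "proj (x - y) z = proj (y - x) z"
  by (metis minus_diff_eq proj_minus_left)

lemma kinkE:
  assumes "kink p t b a"
  obtains e where "e > 0" "\<And>s. t - e \<le> s \<Longrightarrow> s \<le> t \<Longrightarrow> p s = p t + (s - t) *\<^sub>R b"
    "\<And>s. t \<le> s \<Longrightarrow> s \<le> t + e \<Longrightarrow> p s = p t + (s - t) *\<^sub>R a"
proof -
  obtain e where e: "e > 0" "\<forall>s. t - e \<le> s \<longrightarrow> s \<le> t \<longrightarrow> p s = p t + (s - t) *\<^sub>R b"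
    "\<forall>s. t \<le> s \<longrightarrow> s \<le> t + e \<longrightarrow> p s = p t + (s - t) *\<^sub>R a"
    using assms unfolding kink_def by (elim exE conjE)
  show thesis
    by (rule that[OF e(1) e(2,3)[rule_format]])
qed

lemma kinkI:
  assumes "e > 0" "\<And>s. t - e \<le> s \<Longrightarrow> s \<le> t \<Longrightarrow> p s = p t + (s - t) *\<^sub>R b"
    "\<And>s. t \<le> s \<Longrightarrow> s \<le> t + e \<Longrightarrow> p s = p t + (s - t) *\<^sub>R a"
  shows "kink p t b a"
  unfolding kink_def by (intro exI[of _ e] conjI allI impI assms)

lemma kink_cong:
  assumes "kink p t b a" "d > 0" "\<And>s. s \<in> {t-d..t+d} \<Longrightarrow> q s = p s"
  shows "kink q t b a"
  using assms(1)
proof (cases rule: kinkE)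
  case e: (1 e)
  show ?thesis
    by (rule kinkI[of "min e d"]) (use e(1) assms(2) in \<open>auto simp: assms(3) intro!: e(2,3)\<close>)
qed

lemma kink_line:
  assumes "d > 0" "\<And>s. s \<in> {t-d..t+d} \<Longrightarrow> q s = p + s *\<^sub>R v"
  shows "kink q t v v"
  by (rule kinkI[of d]) (use assms in \<open>auto simp: algebra_simps\<close>)

lemma lawful_cong:
  assumes "lawful \<delta> n x t" "d > 0" "\<And>i s. i < n \<Longrightarrow> s \<in> {t-d..t+d} \<Longrightarrow> y i s = x i s"
  shows "lawful \<delta> n y t"
proof -
  have eq: "y i t = x i t" if "i < n" for i
    using assms(2,3) that by auto
  have k: "kink (y i) t b a" if "i < n" "kink (x i) t b a" for i b a
    using kink_cong[OF that(2) assms(2)] assms(3)[OF that(1)] by auto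
  have ap: "apart \<delta> n (\<lambda>i. y i t) \<longleftrightarrow> apart \<delta> n (\<lambda>i. x i t)"
    by (auto simp: apart_def eq)
  have ape: "apart_except \<delta> n i j (\<lambda>i. y i t) \<longleftrightarrow> apart_except \<delta> n i j (\<lambda>i. x i t)" for i j
    by (auto simp: apart_except_def eq)
  from assms(1) show ?thesis
  proof (cases rule: lawfulE)
    case (free b)
    then show ?thesis
      using k ap by (intro lawful_freeI[of n y t b]) auto
  next
    case (hit b a i j)
    then show ?thesis
      using k ape eq by (intro lawful_hitI[of n y t b a i j]) auto
  qed
qed

lemma lawful_lines:
  assumes "d > 0" "\<And>i s. i < n \<Longrightarrow> s \<in> {t-d..t+d} \<Longrightarrow> x i s = p i + s *\<^sub>R v i"
    and "apart \<delta> n (\<lambda>i. p i + t *\<^sub>R v i)"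
  shows "lawful \<delta> n x t"
proof -
  have eq: "x i t = p i + t *\<^sub>R v i" if "i < n" for i
    using assms(1,2) that by auto
  show ?thesis
  proof (rule lawful_freeI)
    show "kink (x i) t (v i) (v i)" if "i < n" for i
      using kink_line[OF assms(1)] assms(2) that by blast
    show "apart \<delta> n (\<lambda>i. x i t)"
      using assms(3) by (auto simp: apart_def eq)
  qed
qed

section \<open>Building motions piece by piece\<close>

lemma reach_start:
  assumes "\<And>t. t \<le> T \<Longrightarrow> apart \<delta> n (\<lambda>i. p i + t *\<^sub>R v i)" "\<And>i. i < n \<Longrightarrow> norm (v i) \<le> V"
  shows "reach \<delta> n 0 V T p v"
  unfolding reach_def
proof (intro exI[of _ "\<lambda>i t. p i + t *\<^sub>R v i"] conjI allI impI)
  show "lawful \<delta> n (\<lambda>i t. p i + t *\<^sub>R v i) t" if "t \<le> T" for t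
    by (rule lawful_lines[of 1]) (use assms(1) that in auto)
  show "\<exists>T'<T. \<forall>i<n. \<forall>t\<ge>T'. p i + t *\<^sub>R v i = p i + t *\<^sub>R v i"
    by (intro exI[of _ "T - 1"]) auto
  show "norm (p i + s *\<^sub>R v i - (p i + t *\<^sub>R v i)) \<le> V * \<bar>s - t\<bar>" if "i < n" for i s t
  proof -
    have "norm (p i + s *\<^sub>R v i - (p i + t *\<^sub>R v i)) = norm (v i) * \<bar>s - t\<bar>"
      by (simp add: scaleR_left_diff_distrib[symmetric])
    then show ?thesis
      using assms(2)[OF that] by (simp add: mult_right_mono)
  qed
  show "\<exists>C. finite C \<and> card C = 0 \<and> C \<subseteq> {..T} \<and> C \<subseteq> contact_times \<delta> n (\<lambda>i t. p i + t *\<^sub>R v i)"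
    by (intro exI[of _ "{}"]) auto
qed

lemma reach_finish:
  fixes p v :: "nat \<Rightarrow> 'a::euclidean_space"
  assumes "reach \<delta> n N V T p v" "\<And>t. t \<ge> T \<Longrightarrow> apart \<delta> n (\<lambda>i. p i + t *\<^sub>R v i)"
  shows "\<exists>x :: nat \<Rightarrow> real \<Rightarrow> 'a. (\<forall>t. lawful \<delta> n x t) \<and> (\<exists>C. finite C \<and> card C = N \<and> C \<subseteq> contact_times \<delta> n x)"
using assms(1)
proof (cases rule: reachE)
  case x: (1 x T' C)
  have "lawful \<delta> n x t" if "t > T" for t
    by (rule lawful_lines[of "t - T'"]) (use assms(2) x(2,3) that in auto)
  then have "\<forall>t. lawful \<delta> n x t"
    using x(1) linorder_not_le by blast
  then show ?thesis
    using x(5,6,8) by (intro exI[of _ x] conjI exI[of _ C])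
qed

lemma reach_wait:
  assumes "reach \<delta> n N V T p v" "T \<le> U"
    and "\<And>t. T < t \<Longrightarrow> t \<le> U \<Longrightarrow> apart \<delta> n (\<lambda>i. p i + t *\<^sub>R v i)"
  shows "reach \<delta> n N V U p v"
using assms(1)
proof (cases rule: reachE)
  case x: (1 x T' C)
  have l: "lawful \<delta> n x t" if "t \<le> U" for t
  proof (cases "t \<le> T")
    case False
    show ?thesis
      by (rule lawful_lines[of "t - T'"]) (use assms(3) x(2,3) that False in auto)
  qed (use x in auto)
  have C: "C \<subseteq> {..U}" "T' < U"
    using x(2,7) assms(2) by auto
  show ?thesis
    by (rule reachI[OF l C(2) x(3,4,5,6) C(1) x(8)])
qed

text \<open>The squared norm is a convex quadratic in \<open>h\<close> whose derivative at 0 is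
  negative, so it is larger at every negative \<open>h\<close>. For two balls on straight lines: if
  they approach now, they were farther apart at all earlier times.\<close>

lemma norm_approach_strict:
  fixes d w :: "'a::euclidean_space"
  assumes "d \<bullet> w < 0" "h < 0"
  shows "norm d < norm (d + h *\<^sub>R w)"
proof -
  have "0 < h * (d \<bullet> w)" "0 \<le> (h *\<^sub>R w) \<bullet> (h *\<^sub>R w)"
    using mult_neg_neg[OF assms(2,1)] by (auto simp del: inner_scaleR_left inner_scaleR_right)
  then have "d \<bullet> d < (d + h *\<^sub>R w) \<bullet> (d + h *\<^sub>R w)"
    by (simp add: inner_left_distrib inner_right_distrib inner_commute)
  then show ?thesis
    by (simp add: norm_eq_sqrt_inner)
qed

lemma apart_exceptD:
  assumes "apart_except \<delta> n i j q" "\<delta> < norm (q i - q j)"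
  shows "apart \<delta> n q"
  using assms unfolding apart_def apart_except_def
  by (metis doubleton_eq_iff norm_minus_commute)

text \<open>The hypotheses keep apart only the other pairs. The colliding pair takes care of itself:
  it approaches up to time \<open>s\<close> and separates afterwards.\<close>

lemma reach_collide:
  fixes p v p' v' :: "nat \<Rightarrow> 'a::euclidean_space"
  assumes R: "reach \<delta> n N V T p v" and s: "T < s" "s < T'" and ij: "i < n" "j < n" "i \<noteq> j"
    and "0 < \<delta>"
    and w: "w = p i + s *\<^sub>R v i - (p j + s *\<^sub>R v j)" "norm w = \<delta>" "(v i - v j) \<bullet> w < 0"
    and v': "\<And>k. k < n \<Longrightarrow> v' k = collide w i j v k"
    and p': "\<And>k. k < n \<Longrightarrow> p' k + s *\<^sub>R v' k = p k + s *\<^sub>R v k"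
    and V: "\<And>k. k < n \<Longrightarrow> norm (v' k) \<le> V"
    and before: "\<And>t. T \<le> t \<Longrightarrow> t \<le> s \<Longrightarrow> apart_except \<delta> n i j (\<lambda>k. p k + t *\<^sub>R v k)"
    and after: "\<And>t. s \<le> t \<Longrightarrow> t \<le> T' \<Longrightarrow> apart_except \<delta> n i j (\<lambda>k. p' k + t *\<^sub>R v' k)"
  shows "reach \<delta> n (Suc N) V T' p' v'"
using R
proof (cases rule: reachE)
  case x: (1 x U C)
  define y where "y k t = (if t \<le> s then x k t else p' k + t *\<^sub>R v' k)" for k t
  have y1: "y k t = p k + t *\<^sub>R v k" if "k < n" "U \<le> t" "t \<le> s" for k t
    using x(3) that by (auto simp: y_def)
  have y2: "y k t = p' k + t *\<^sub>R v' k" if "k < n" "s \<le> t" for k t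
    using y1[of k s] p'[of k] s x(2) that by (cases "t = s") (auto simp: y_def)
  have yx: "y k t = x k t" if "t \<le> s" for k t
    using that by (simp add: y_def)
  have w0: "w \<noteq> 0"
    using w(2) \<open>0 < \<delta>\<close> by auto
  have vij: "v' i = v i - proj w (v i - v j)" "v' j = v j + proj w (v i - v j)"
    using v' ij proj_minus[of w "v i - v j"] by (auto simp: collide_def)
  \<comment> \<open>The impact reverses the normal component of the relative velocity. With time
    reversed, the separation after \<open>s\<close> is therefore again an approach, and one
    inequality serves both sides.\<close>
  have w': "(v' i - v' j) \<bullet> w = - ((v i - v j) \<bullet> w)"
    using inner_proj[OF w0, of "v i - v j"]
    by (simp add: vij inner_diff_left inner_add_left algebra_simps)
  have ij1: "\<delta> < norm (p i + t *\<^sub>R v i - (p j + t *\<^sub>R v j))" if "t < s" for t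
  proof -
    have "p i + t *\<^sub>R v i - (p j + t *\<^sub>R v j) = w + (t - s) *\<^sub>R (v i - v j)"
      by (simp add: w(1) algebra_simps)
    then show ?thesis
      using norm_approach_strict[of w "v i - v j" "t - s"] w(2,3) that by (simp add: inner_commute)
  qed
  have ij2: "\<delta> < norm (p' i + t *\<^sub>R v' i - (p' j + t *\<^sub>R v' j))" if "s < t" for t
  proof -
    have "p' i + t *\<^sub>R v' i - (p' j + t *\<^sub>R v' j)
       = (p' i + s *\<^sub>R v' i) - (p' j + s *\<^sub>R v' j) + (t - s) *\<^sub>R (v' i - v' j)"
      by (simp add: algebra_simps)
    also have "\<dots> = w + (s - t) *\<^sub>R (v' j - v' i)"
      using p' ij by (simp add: w(1) algebra_simps)
    finally show ?thesis
      using norm_approach_strict[of w "v' j - v' i" "s - t"] w w' that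
      by (simp add: inner_commute inner_diff_right inner_diff_left)
  qed
  have law: "lawful \<delta> n y t" if "t \<le> T'" for t
  proof -
    consider "t \<le> T" | "T < t" "t < s" | "t = s" | "s < t" by linarith
    then show ?thesis
    proof cases
      case 1
      show ?thesis
        by (rule lawful_cong[of _ _ x _ "s - T"]) (use 1 x s yx in auto)
    next
      case 2
      show ?thesis
      proof (rule lawful_lines[of "min (t - U) (s - t)"])
        show "apart \<delta> n (\<lambda>k. p k + t *\<^sub>R v k)"
          using apart_exceptD[OF before[of t] ij1] 2 by auto
      qed (use 2 x(2) y1 in auto)
    next
      case 3
      have "kink (y k) t (v k) (v' k)" if "k < n" for k
        using that 3 s x(2) p'[OF that] by (intro kinkI[of "s - U"]) (auto simp: y1 y2 algebra_simps)
      moreover have yw: "y i t - y j t = w"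
        using y1[of i s] y1[of j s] ij s x(2) 3 by (simp add: w(1))
      moreover have "apart_except \<delta> n i j (\<lambda>k. y k t)"
        using before[of s] s 3 x(2) by (auto simp: apart_except_def y1)
      ultimately show ?thesis
        using ij w v' by (intro lawful_hitI[of n y t v v' i j]) auto
    next
      case 4
      show ?thesis
      proof (rule lawful_lines[of "t - s"])
        show "apart \<delta> n (\<lambda>k. p' k + t *\<^sub>R v' k)"
          using apart_exceptD[OF after[of t] ij2] 4 that by auto
      qed (use 4 y2 in auto)
    qed
  qed
  have lip0: "norm (y k r - y k t) \<le> V * (r - t)" if k: "k < n" and le: "t \<le> r" for k r t
  proof -
    have a: "norm (y k r - y k t) \<le> V * (r - t)" if "s \<le> t" "t \<le> r" for r t
    proof -
      have "y k r - y k t = (r - t) *\<^sub>R v' k"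
        using that k by (simp add: y2 algebra_simps)
      then have "norm (y k r - y k t) = (r - t) * norm (v' k)"
        using that by simp
      then show ?thesis
        using mult_left_mono[OF V[OF k], of "r - t"] that by (simp add: mult.commute)
    qed
    have b: "norm (y k r - y k t) \<le> V * (r - t)" if "r \<le> s" "t \<le> r" for r t
      using x(4)[OF k, of r t] that by (simp add: yx)
    consider "r \<le> s" | "s \<le> t" | "t \<le> s" "s \<le> r" by linarith
    then show ?thesis
    proof cases
      case 3
      have "norm (y k r - y k t) \<le> norm (y k r - y k s) + norm (y k s - y k t)"
        using norm_triangle_ineq[of "y k r - y k s" "y k s - y k t"] by simp
      also have "\<dots> \<le> V * (r - s) + V * (s - t)"
        using a[of s r] b[of s t] 3 by auto
      finally show ?thesis
        by (simp add: algebra_simps)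
    qed (use a b le in auto)
  qed
  have lip: "norm (y k r - y k t) \<le> V * \<bar>r - t\<bar>" if k: "k < n" for k r t
    using lip0[OF k, of r t] lip0[OF k, of t r] by (cases "r \<le> t") (auto simp: norm_minus_commute)
  have "y i s - y j s = w"
    using y1[of i s] y1[of j s] ij s x(2) by (simp add: w(1))
  then have sC: "s \<in> contact_times \<delta> n y"
    using ij w(2) by (auto simp: contact_times_def)
  have CC: "C \<subseteq> contact_times \<delta> n y"
  proof
    fix t assume "t \<in> C"
    then have "t \<le> s" "t \<in> contact_times \<delta> n x"
      using x(7,8) s by auto
    then show "t \<in> contact_times \<delta> n y"
      by (simp add: contact_times_def yx)
  qed
  have "s \<notin> C"
    using x(7) s by auto
  then show ?thesis
    using s x(5-7) sC CC by (intro reachI[OF law _ y2 lip, where C = "insert s C"]) auto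
qed

lemma reach_shift:
  assumes "reach \<delta> n N V T p v"
  shows "reach \<delta> n N V (T - r) (\<lambda>i. p i + r *\<^sub>R v i) v"
using assms
proof (cases rule: reachE)
  case x: (1 x U C)
  define y where "y i t = x i (t + r)" for i t
  have k: "kink (y i) t b a" if "kink (x i) (t + r) b a" for i t a b
  using that
  proof (cases rule: kinkE)
    case e: (1 e)
    show ?thesis
    proof (rule kinkI[of e])
      show "y i s = y i t + (s - t) *\<^sub>R b" if "t - e \<le> s" "s \<le> t" for s
        using e(2)[of "s + r"] that by (simp add: y_def)
      show "y i s = y i t + (s - t) *\<^sub>R a" if "t \<le> s" "s \<le> t + e" for s
        using e(3)[of "s + r"] that by (simp add: y_def)
    qed (rule e(1))
  qed
  have law: "lawful \<delta> n y t" if "t \<le> T - r" for t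
  proof -
    have "lawful \<delta> n x (t + r)"
      using x(1) that by auto
    then show ?thesis
    proof (cases rule: lawfulE)
      case (free b)
      then show ?thesis
        using k by (intro lawful_freeI[of n y t b]) (auto simp: y_def)
    next
      case (hit b a i j)
      then show ?thesis
        using k by (intro lawful_hitI[of n y t b a i j]) (auto simp: y_def)
    qed
  qed
  have C: "(\<lambda>t. t - r) ` C \<subseteq> contact_times \<delta> n y"
    using x(8) by (force simp: contact_times_def y_def)
  have card: "card ((\<lambda>t. t - r) ` C) = N"
    using x(6) by (subst card_image) (auto simp: inj_on_def)
  show ?thesis
  proof (rule reachI[of _ _ _ y "U - r", OF law _ _ _ _ card _ C])
    show "norm (y i s - y i t) \<le> V * \<bar>s - t\<bar>" if "i < n" for i s t
      using x(4)[OF that, of "s + r" "t + r"] by (simp add: y_def)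
  qed (use x(2,3,5,7) in \<open>auto simp: y_def algebra_simps\<close>)
qed

text \<open>Space and time are dilated by the same factor, which leaves velocities, the collision
  rule and the speed bound unchanged.\<close>

lemma reach_scale:
  assumes "reach \<delta> n N V T p v" "c > 0"
  shows "reach (c * \<delta>) n N V (c * T) (\<lambda>i. c *\<^sub>R p i) v"
using assms(1)
proof (cases rule: reachE)
  case x: (1 x U C)
  define y where "y i t = c *\<^sub>R x i (t / c)" for i t
  have diff: "y i t - y j t = c *\<^sub>R (x i (t / c) - x j (t / c))" for i j t
    by (simp add: y_def algebra_simps)
  have dist: "norm (y i t - y j t) = c * norm (x i (t / c) - x j (t / c))" for i j t
    using assms(2) by (simp add: diff)
  have k: "kink (y i) t b a" if "kink (x i) (t / c) b a" for i t a b
  using that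
  proof (cases rule: kinkE)
    case e: (1 e)
    have c: "c * (s / c - t / c) = s - t" for s
      using assms(2) by (simp add: diff_divide_distrib[symmetric])
    have le: "t / c - e \<le> s / c" if "t - c * e \<le> s" for s
      using divide_right_mono[OF that, of c] assms(2) by (simp add: diff_divide_distrib)
    have ge: "s / c \<le> t / c + e" if "s \<le> t + c * e" for s
      using divide_right_mono[OF that, of c] assms(2) by (simp add: add_divide_distrib)
    have y: "y i s = y i t + (s - t) *\<^sub>R d" if "x i (s / c) = x i (t / c) + (s / c - t / c) *\<^sub>R d" for s d
      unfolding y_def that scaleR_right_distrib scaleR_scaleR c ..
    have mono: "r / c \<le> s / c" if "r \<le> s" for r s
      using that assms(2) by (intro divide_right_mono) auto
    have l: "y i s = y i t + (s - t) *\<^sub>R b" if "t - c * e \<le> s" "s \<le> t" for s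
      by (rule y[OF e(2)[OF le[OF that(1)] mono[OF that(2)]]])
    have r: "y i s = y i t + (s - t) *\<^sub>R a" if "t \<le> s" "s \<le> t + c * e" for s
      by (rule y[OF e(3)[OF mono[OF that(1)] ge[OF that(2)]]])
    show ?thesis
      by (rule kinkI[of "c * e", OF _ l r]) (simp_all add: e(1) assms(2))
  qed
  have cp: "proj (c *\<^sub>R w) z = proj w z" for w z :: 'a
    using assms(2) by (simp add: proj_def power2_eq_square)
  have cc: "collide (c *\<^sub>R w) i j b k = collide w i j b k" for w :: 'a and b and i j k :: nat
    by (simp add: collide_def cp)
  have ap: "apart (c * \<delta>) n (\<lambda>i. y i t) = apart \<delta> n (\<lambda>i. x i (t / c))"
    "apart_except (c * \<delta>) n i j (\<lambda>i. y i t) = apart_except \<delta> n i j (\<lambda>i. x i (t / c))" for t i j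
    using assms(2) by (simp_all add: apart_def apart_except_def dist)
  have law: "lawful (c * \<delta>) n y t" if "t \<le> c * T" for t
  proof -
    have "lawful \<delta> n x (t / c)"
      using x(1) that assms(2) by (simp add: field_simps)
    then show ?thesis
    proof (cases rule: lawfulE)
      case (free b)
      then show ?thesis
        using k ap by (intro lawful_freeI[of n y t b]) auto
    next
      case (hit b a i j)
      then show ?thesis
        using k assms(2)
        by (intro lawful_hitI[of n y t b a i j]) (auto simp: ap dist diff cc mult_less_0_iff)
    qed
  qed
  have C: "(*) c ` C \<subseteq> contact_times (c * \<delta>) n y"
  proof
    fix t assume "t \<in> (*) c ` C"
    then obtain r where "r \<in> C" "t = c * r" by auto
    moreover have "r \<in> contact_times \<delta> n x" using x(8) \<open>r \<in> C\<close> by blast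
    ultimately show "t \<in> contact_times (c * \<delta>) n y"
      using assms(2) by (auto simp: contact_times_def dist)
  qed
  have card: "card ((*) c ` C) = N"
    using x(6) assms(2) by (subst card_image) (auto simp: inj_on_def)
  have lip: "norm (y i s - y i t) \<le> V * \<bar>s - t\<bar>" if "i < n" for i s t
  proof -
    have "norm (y i s - y i t) = c * norm (x i (s/c) - x i (t/c))"
      using assms(2) by (simp add: y_def scaleR_right_diff_distrib[symmetric])
    also have "\<dots> \<le> c * (V * \<bar>s/c - t/c\<bar>)"
      using x(4)[OF that] assms(2) by (simp add: mult_left_mono)
    also have "\<dots> = V * \<bar>s - t\<bar>"
      using assms(2) by (simp add: diff_divide_distrib[symmetric] abs_divide)
    finally show ?thesis .
  qed
  have lin: "y i t = c *\<^sub>R p i + t *\<^sub>R v i" if "i < n" "c * U \<le> t" for i t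
    using x(3)[OF that(1), of "t / c"] that(2) assms(2) by (simp add: y_def field_simps)
  show ?thesis
    by (rule reachI[of _ _ _ y "c * U", OF law _ lin lip _ card _ C])
       (use x(2,5,7) assms(2) in auto)
qed

text \<open>Backwards from time 0, the new ball recedes in the direction of \<open>- b\<close> at
  least as fast as any old ball can follow, and it starts more than \<open>\<delta>\<close> behind
  all of them. So it has touched nothing in the past. It gets index 0 and the old indices move up by
  one.\<close>

lemma reach_insert:
  fixes b :: "'a::euclidean_space"
  assumes R: "reach \<delta> n N V 0 p v" and b: "norm b = 1"
    and q: "\<And>i. i < n \<Longrightarrow> \<delta> < (p i - q) \<bullet> b" and f: "V \<le> f \<bullet> b" "norm f \<le> W" "V \<le> W"
  shows "reach \<delta> (Suc n) N W 0 (case_nat q p) (case_nat f v)"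
using R
proof (cases rule: reachE)
  case x: (1 x U C)
  define y where "y = case_nat (\<lambda>t. q + t *\<^sub>R f) x"
  have y0: "y 0 = (\<lambda>t. q + t *\<^sub>R f)" and yS: "\<And>i. y (Suc i) = x i"
    by (simp_all add: y_def)
  have far: "\<delta> < norm (x i t - (q + t *\<^sub>R f))" if "i < n" "t \<le> 0" for i t
  proof -
    have "x i 0 = p i"
      using x(2,3) that by auto
    then have "norm (x i t - p i) \<le> V * (- t)"
      using x(4)[OF that(1), of t 0] that(2) by simp
    then have "- (V * (- t)) \<le> (x i t - p i) \<bullet> b"
      using Cauchy_Schwarz_ineq2[of "x i t - p i" b] b by auto
    moreover have "V * (- t) \<le> (f \<bullet> b) * (- t)"
      using f(1) that(2) by (intro mult_right_mono) auto
    moreover have "(x i t - (q + t *\<^sub>R f)) \<bullet> b = (x i t - p i) \<bullet> b + (p i - q) \<bullet> b + (f \<bullet> b) * (- t)"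
      by (simp add: inner_diff_left inner_add_left)
    ultimately have "\<delta> < (x i t - (q + t *\<^sub>R f)) \<bullet> b"
      using q[OF that(1)] by linarith
    also have "\<dots> \<le> norm (x i t - (q + t *\<^sub>R f))"
      using norm_cauchy_schwarz[of "x i t - (q + t *\<^sub>R f)" b] b by simp
    finally show ?thesis .
  qed
  have far': "\<delta> < norm (q + t *\<^sub>R f - x i t)" if "i < n" "t \<le> 0" for i t
    using far[OF that] by (simp add: norm_minus_commute)
  have law: "lawful \<delta> (Suc n) y t" if t: "t \<le> 0" for t
  proof -
    have k: "kink (y i) t (case_nat f c i) (case_nat f a i)"
      if "\<And>i. i < n \<Longrightarrow> kink (x i) t (c i) (a i)" "i < Suc n" for c a i
      using that kink_line[of 1 _ "y 0" q f] by (cases i) (auto simp: y0 yS)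
    have "lawful \<delta> n x t"
      using x(1) t by auto
    then show ?thesis
    proof (cases rule: lawfulE)
      case (free c)
      have "apart \<delta> (Suc n) (\<lambda>i. y i t)"
        unfolding apart_def
      proof (intro allI impI)
        fix k l assume "k < Suc n" "l < Suc n" "k \<noteq> l"
        then show "\<delta> < norm (y k t - y l t)"
          using free(2) far[of _ t] far'[of _ t] t by (cases k; cases l) (auto simp: y0 yS apart_def)
      qed
      then show ?thesis
        using k[of c c] free by (intro lawful_freeI[of "Suc n" y t "case_nat f c"]) auto
    next
      case (hit c a i j)
      have "apart_except \<delta> (Suc n) (Suc i) (Suc j) (\<lambda>i. y i t)"
        unfolding apart_except_def
      proof (intro allI impI)
        fix k l assume "k < Suc n" "l < Suc n" "k \<noteq> l" "{k, l} \<noteq> {Suc i, Suc j}"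
        then show "\<delta> < norm (y k t - y l t)"
          using hit(7) far[of _ t] far'[of _ t] t
          by (cases k; cases l) (auto simp: y0 yS apart_except_def doubleton_eq_iff)
      qed
      moreover have "case_nat f a k
          = collide (y (Suc i) t - y (Suc j) t) (Suc i) (Suc j) (case_nat f c) k" if "k < Suc n" for k
        using hit(8) that by (cases k) (auto simp: yS collide_def)
      ultimately show ?thesis
        using k[of c a] hit
        by (intro lawful_hitI[of "Suc n" y t "case_nat f c" "case_nat f a" "Suc i" "Suc j"])
           (auto simp: yS)
    qed
  qed
  have lip: "norm (y i s - y i t) \<le> W * \<bar>s - t\<bar>" if "i < Suc n" for i s t
  proof (cases i)
    case 0
    have "norm (y i s - y i t) = norm f * \<bar>s - t\<bar>"
      by (simp add: 0 y0 scaleR_left_diff_distrib[symmetric])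
    then show ?thesis
      using f(2) by (simp add: mult_right_mono)
  next
    case (Suc k)
    then have "norm (y i s - y i t) \<le> V * \<bar>s - t\<bar>"
      using x(4) that by (simp add: yS)
    also have "\<dots> \<le> W * \<bar>s - t\<bar>"
      using f(3) by (simp add: mult_right_mono)
    finally show ?thesis .
  qed
  have lin: "y i t = case_nat q p i + t *\<^sub>R case_nat f v i" if "i < Suc n" "U \<le> t" for i t
    using that x(3) by (cases i) (auto simp: y0 yS)
  have C: "C \<subseteq> contact_times \<delta> (Suc n) y"
  proof
    fix t assume "t \<in> C"
    then obtain i j where "i < n" "j < n" "i \<noteq> j" "norm (x i t - x j t) = \<delta>"
      using x(8) by (auto simp: contact_times_def)
    then show "t \<in> contact_times \<delta> (Suc n) y"
      unfolding contact_times_def by (intro CollectI) (use yS in \<open>metis Suc_less_eq nat.inject\<close>)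
  qed
  show ?thesis
    by (rule reachI[OF law x(2) lin lip x(5-7) C])
qed

section \<open>Lawful motions are evolutions\<close>

lemma kink_velocity:
  assumes "kink p t b a"
  shows "p differentiable (at_right t)" "velocity p t = a"
    "(velocity p \<longlongrightarrow> b) (at_left t)" "velocity_before p t = b" "isCont p t"
    "\<exists>e>0. \<forall>s. t - e < s \<longrightarrow> s < t \<longrightarrow> velocity p s = b"
    "\<exists>e>0. \<forall>s. t < s \<longrightarrow> s < t + e \<longrightarrow> velocity p s = a"
proof -
  \<comment> \<open>Stated at an arbitrary \<open>r\<close>, since the left limit at
    \<open>t\<close> involves the right derivatives at all times shortly before
    \<open>t\<close>.\<close>
  have right: "(p has_vector_derivative d) (at_right r)"
    if ru: "r < u" and lin: "\<And>s. r \<le> s \<Longrightarrow> s < u \<Longrightarrow> p s = p r + (s - r) *\<^sub>R d" for r u d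
  proof -
    define q where "q = (r + u) / 2"
    have q: "r < q" "q < u"
      using ru by (simp_all add: q_def)
    have "((\<lambda>s. p r + (s - r) *\<^sub>R d) has_vector_derivative d) (at r within {r..q})"
      by (auto intro!: derivative_eq_intros)
    then have "(p has_vector_derivative d) (at r within {r..q})"
    proof (rule has_vector_derivative_transform[rotated 2])
      show "r \<in> {r..q}"
        using q by simp
      show "p s = p r + (s - r) *\<^sub>R d" if "s \<in> {r..q}" for s
        by (rule lin) (use that q in auto)
    qed
    then show ?thesis
      by (simp add: at_within_Icc_at_right[OF q(1)])
  qed
  have vel: "velocity p r = d"
    if "r < u" "\<And>s. r \<le> s \<Longrightarrow> s < u \<Longrightarrow> p s = p r + (s - r) *\<^sub>R d" for r u d
    unfolding velocity_def
    by (rule vector_derivative_within[OF _ right[OF that]]) auto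
  obtain e where e: "e > 0" "\<forall>s. t - e \<le> s \<longrightarrow> s \<le> t \<longrightarrow> p s = p t + (s - t) *\<^sub>R b"
    "\<forall>s. t \<le> s \<longrightarrow> s \<le> t + e \<longrightarrow> p s = p t + (s - t) *\<^sub>R a"
    using assms unfolding kink_def by (elim exE conjE)
  have "t < t + e"
    using e(1) by simp
  have er: "p s = p t + (s - t) *\<^sub>R a" if "t \<le> s" "s < t + e" for s
    by (rule e(3)[rule_format]) (use that in auto)
  have el: "p s = p t + (s - t) *\<^sub>R b" if "t - e < s" "s \<le> t" for s
    by (rule e(2)[rule_format]) (use that in auto)
  have R: "(p has_vector_derivative a) (at_right t)"
    by (rule right[OF \<open>t < t + e\<close> er])
  show "p differentiable (at_right t)"
    using R by (rule differentiableI_vector)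
  show "velocity p t = a"
    by (rule vel[OF \<open>t < t + e\<close> er])
  have L: "velocity p r = b" if "t - e < r" "r < t" for r
  proof (rule vel[of r t])
    fix s assume s: "r \<le> s" "s < t"
    have "p s = p t + (s - t) *\<^sub>R b" and "p r = p t + (r - t) *\<^sub>R b"
      by (rule el; use s that in linarith)+
    then show "p s = p r + (s - r) *\<^sub>R b"
      by (simp only: scaleR_left_diff_distrib) simp
  qed (use that in auto)
  then show "\<exists>e>0. \<forall>s. t - e < s \<longrightarrow> s < t \<longrightarrow> velocity p s = b"
    using e(1) by blast
  have "velocity p r = a" if "t < r" "r < t + e" for r
  proof (rule vel[of r "t + e"])
    fix s assume s: "r \<le> s" "s < t + e"
    have "p s = p t + (s - t) *\<^sub>R a" and "p r = p t + (r - t) *\<^sub>R a"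
      by (rule er; use s that in linarith)+
    then show "p s = p r + (s - r) *\<^sub>R a"
      by (simp only: scaleR_left_diff_distrib) simp
  qed (use that in auto)
  then show "\<exists>e>0. \<forall>s. t < s \<longrightarrow> s < t + e \<longrightarrow> velocity p s = a"
    using e(1) by blast
  have ev: "\<forall>\<^sub>F r in at_left t. velocity p r = b"
    unfolding eventually_at_left_field using L e(1) by (intro exI[of _ "t - e"]) auto
  then show lim: "(velocity p \<longlongrightarrow> b) (at_left t)"
    by (rule tendsto_eventually)
  show "velocity_before p t = b"
    unfolding velocity_before_def by (rule tendsto_Lim[OF _ lim]) auto
  have "((\<lambda>s. p t + (s - t) *\<^sub>R b) \<longlongrightarrow> p t) (at_left t)" "((\<lambda>s. p t + (s - t) *\<^sub>R a) \<longlongrightarrow> p t) (at_right t)"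
    by (auto intro!: tendsto_eq_intros)
  moreover have "\<forall>\<^sub>F s in at_left t. p t + (s - t) *\<^sub>R b = p s"
    unfolding eventually_at_left_field using e(1) by (intro exI[of _ "t - e"]) (auto intro!: el[symmetric])
  moreover have "\<forall>\<^sub>F s in at_right t. p t + (s - t) *\<^sub>R a = p s"
    unfolding eventually_at_right_field using e(1) by (intro exI[of _ "t + e"]) (auto intro!: er[symmetric])
  ultimately have "(p \<longlongrightarrow> p t) (at_left t)" "(p \<longlongrightarrow> p t) (at_right t)"
    using Lim_transform_eventually by blast+
  then show "isCont p t"
    unfolding isCont_def by (simp add: filterlim_split_at)
qed

locale lawful_motion =
  fixes n :: nat and x :: "nat \<Rightarrow> real \<Rightarrow> 'a::euclidean_space"
  assumes lawful: "\<And>t. lawful 2 n x t"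
begin

lemma law_cases:
  obtains (free) "apart 2 n (\<lambda>i. x i t)"
      "\<And>i. i < n \<Longrightarrow> kink (x i) t (velocity (x i) t) (velocity (x i) t)"
  | (hit) i j where "i < n" "j < n" "i \<noteq> j"
      "touching x i j t" "apart_except 2 n i j (\<lambda>i. x i t)"
      "(velocity_before (x i) t - velocity_before (x j) t) \<bullet> (x i t - x j t) < 0"
      "\<And>k. k < n \<Longrightarrow> kink (x k) t (velocity_before (x k) t) (velocity (x k) t)"
      "\<And>k. k < n \<Longrightarrow> velocity (x k) t = collide (x i t - x j t) i j (\<lambda>k. velocity_before (x k) t) k"
  using lawful[of t]
proof (cases rule: lawfulE)
  case (free b)
  then show thesis
    using that(1) kink_velocity(2) by metis
next
  case (hit b a i j)
  have a: "velocity (x k) t = a k" and b: "velocity_before (x k) t = b k" if "k < n" for k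
    using kink_velocity(2,4)[OF hit(1)[OF that]] .
  show thesis
  proof (rule that(2)[OF hit(2-4)])
    show "kink (x k) t (velocity_before (x k) t) (velocity (x k) t)" if "k < n" for k
      using hit(1)[OF that] a[OF that] b[OF that] by simp
    show "velocity (x k) t = collide (x i t - x j t) i j (\<lambda>k. velocity_before (x k) t) k" if "k < n" for k
      using hit(8)[OF that] a[OF that] b[OF that] b[OF hit(2)] b[OF hit(3)] by (simp add: collide_def)
  qed (use hit(2,3,5-7) b in \<open>simp_all add: touching_def\<close>)
qed

lemma kink_ex:
  assumes "i < n"
  shows "kink (x i) t (velocity_before (x i) t) (velocity (x i) t)"
proof (cases t rule: law_cases)
  case free
  then show ?thesis
    using kink_velocity(4)[OF free(2)[OF assms]] assms by simp
qed (use assms in blast)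

lemma norm_ge_2:
  assumes "i < n" "j < n" "i \<noteq> j"
  shows "2 \<le> norm (x i t - x j t)"
proof (cases t rule: law_cases)
  case free
  then show ?thesis
    using assms by (force simp: apart_def)
next
  case (hit k l)
  show ?thesis
  proof (cases "{i, j} = {k, l}")
    case True
    then have "norm (x i t - x j t) = norm (x k t - x l t)"
      by (auto simp: doubleton_eq_iff norm_minus_commute)
    then show ?thesis
      using hit(4) by (simp add: touching_def)
  next
    case False
    then have "2 < norm (x i t - x j t)"
      using hit(5) assms by (simp add: apart_except_def)
    then show ?thesis
      by simp
  qed
qed

text \<open>The law at time \<open>t\<close> provides some touching pair and keeps all others apart,
  so that pair is \<open>i\<close>, \<open>j\<close> up to order; the collision rule is symmetric in
  the two balls.\<close>

lemma touching_hit: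
  assumes "i < n" "j < n" "touching x i j t"
  shows "apart_except 2 n i j (\<lambda>i. x i t)"
    "(velocity_before (x i) t - velocity_before (x j) t) \<bullet> (x i t - x j t) < 0"
    "\<And>k. k < n \<Longrightarrow> velocity (x k) t = collide (x i t - x j t) i j (\<lambda>k. velocity_before (x k) t) k"
proof -
  have ij: "i \<noteq> j"
    using assms(3) by (auto simp: touching_def)
  have "apart_except 2 n i j (\<lambda>i. x i t) \<and>
    (velocity_before (x i) t - velocity_before (x j) t) \<bullet> (x i t - x j t) < 0 \<and>
    (\<forall>k<n. velocity (x k) t = collide (x i t - x j t) i j (\<lambda>k. velocity_before (x k) t) k)"
  proof (cases t rule: law_cases)
    case free
    then have "2 < norm (x i t - x j t)"
      using assms(1,2) ij unfolding apart_def by blast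
    then show ?thesis
      using assms(3) by (simp add: touching_def)
  next
    case (hit k l)
    have "\<not> 2 < norm (x i t - x j t)"
      using assms(3) by (simp add: touching_def)
    then have "{i, j} = {k, l}"
      using hit(5) assms(1,2) ij unfolding apart_except_def by blast
    then consider "i = k" "j = l" | "i = l" "j = k"
      by (auto simp: doubleton_eq_iff)
    then show ?thesis
    proof cases
      case 1
      then show ?thesis using hit by simp
    next
      case 2
      have "(velocity_before (x l) t - velocity_before (x k) t) \<bullet> (x l t - x k t)
          = (velocity_before (x k) t - velocity_before (x l) t) \<bullet> (x k t - x l t)"
        by (simp add: inner_diff_left inner_diff_right)
      then show ?thesis
        using hit 2 by (simp add: apart_except_def insert_commute collide_def proj_swap[of "x l t"])
    qed
  qed
  then show "apart_except 2 n i j (\<lambda>i. x i t)"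
    "(velocity_before (x i) t - velocity_before (x j) t) \<bullet> (x i t - x j t) < 0"
    "\<And>k. k < n \<Longrightarrow> velocity (x k) t = collide (x i t - x j t) i j (\<lambda>k. velocity_before (x k) t) k"
    by auto
qed

lemma impact_if_touching:
  assumes "i < n" "j < n" "touching x i j t"
  shows "impact n x i j t"
  unfolding impact_def
proof (intro conjI allI impI)
  fix k assume k: "k < n" "k \<noteq> i \<and> k \<noteq> j"
  have "2 < norm (x i t - x k t)" "2 < norm (x j t - x k t)"
    using touching_hit(1)[OF assms] assms(1,2) k
    by (auto simp: apart_except_def doubleton_eq_iff)
  then show "\<not> touching x i k t" "\<not> touching x j k t"
    by (auto simp: touching_def)
qed (use assms touching_hit(2)[OF assms] in auto)

text \<open>Each member of a connected set of three or more balls touches some ball. Given one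
  touching pair, a third member would belong to a second one, but all other pairs have distance
  greater than 2.\<close>

lemma no_simultaneous_collision: "\<not> simultaneous_collision n x t"
proof
  assume "simultaneous_collision n x t"
  then obtain S where S: "S \<subseteq> {..<n}" "card S \<ge> 3"
    "\<And>i j. i \<in> S \<Longrightarrow> j \<in> S \<Longrightarrow> (i, j) \<in> (contacts n x t \<inter> S \<times> S)\<^sup>*"
    by (auto simp: simultaneous_collision_def)
  have contact: "\<exists>j<n. touching x i j t" if i: "i \<in> S" for i
  proof -
    have "\<not> S \<subseteq> {i}"
      using S(2) card_mono[of "{i}" S] by auto
    then obtain k where "k \<in> S" "k \<noteq> i" by auto
    then show ?thesis
      using S(3)[OF i \<open>k \<in> S\<close>] by (auto elim: converse_rtranclE simp: contacts_def)
  qed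
  obtain i where i: "i \<in> S"
    using S(2) by fastforce
  then obtain j where j: "j < n" "touching x i j t"
    using contact by blast
  have "i < n"
    using i S(1) by auto
  have "card {i, j} \<le> 2"
    by (rule card_insert_le_m1) auto
  then have "\<not> S \<subseteq> {i, j}"
    using S(2) card_mono[of "{i, j}" S] by auto
  then obtain k where k: "k \<in> S" "k \<noteq> i" "k \<noteq> j" by auto
  then obtain l where l: "l < n" "touching x k l t"
    using contact by blast
  have "k < n" "k \<noteq> l" "{k, l} \<noteq> {i, j}"
    using k S(1) l(2) by (auto simp: touching_def)
  then have "2 < norm (x k t - x l t)"
    using touching_hit(1)[OF \<open>i < n\<close> j] l(1) unfolding apart_except_def by blast
  then show False
    using l(2) by (simp add: touching_def)
qed

lemma evolution: "evolution n x"
  unfolding evolution_def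
proof (intro conjI allI impI)
  show "continuous_on UNIV (x i)" if "i < n" for i
    using kink_velocity(5)[OF kink_ex[OF that]] by (simp add: continuous_at_imp_continuous_on)
  show "x i differentiable at_right t" if "i < n" for i t
    using kink_velocity(1)[OF kink_ex[OF that]] .
  show "\<exists>v. (velocity (x i) \<longlongrightarrow> v) (at_left t)" if "i < n" for i t
    using kink_velocity(3)[OF kink_ex[OF that]] by blast
  show "ball (x i t) 1 \<inter> ball (x j t) 1 = {}" if "i < n" "j < n" "i \<noteq> j" for t i j
    using norm_ge_2[OF that, of t] by (intro disjoint_ballI) (simp add: dist_norm)
  show "\<not> simultaneous_collision n x t" for t
    by (rule no_simultaneous_collision)
  show "velocity (x i) constant_on {a<..<b}"
    if i: "i < n" and no: "\<forall>t\<in>{a<..<b}. \<forall>j<n. \<not> impact n x i j t" for i a b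
  proof -
    \<comment> \<open>The velocity is shown to be locally constant; connectedness of the interval
      then makes it constant.\<close>
    have "\<forall>\<^sub>F s in at t within {a<..<b}. velocity (x i) t = velocity (x i) s"
      if t: "t \<in> {a<..<b}" for t
    proof -
      have "velocity_before (x i) t = velocity (x i) t"
      proof (cases t rule: law_cases)
        case free
        then show ?thesis
          using kink_velocity(4) i by blast
      next
        case (hit k l)
        \<comment> \<open>Any contact of ball \<open>i\<close> would be an impact, which is excluded
          here. So ball \<open>i\<close> is a bystander of this hit and keeps its velocity.\<close>
        have "i \<noteq> k" "i \<noteq> l"
          using impact_if_touching[of i l t] impact_if_touching[of i k t] hit(1-4) no t
          by (auto simp: touching_def norm_minus_commute)
        then show ?thesis
          using hit(8)[OF i] by (simp add: collide_def)
      qed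
      then obtain e f where ef: "e > 0" "\<forall>s. t - e < s \<longrightarrow> s < t \<longrightarrow> velocity (x i) s = velocity (x i) t"
          "f > 0" "\<forall>s. t < s \<longrightarrow> s < t + f \<longrightarrow> velocity (x i) s = velocity (x i) t"
        using kink_velocity(6,7)[OF kink_ex[OF i, of t]] by metis
      have "velocity (x i) t = velocity (x i) s" if "dist s t < min e f" for s
        using ef(2,4)[rule_format, of s] that by (cases s t rule: linorder_cases) (auto simp: dist_real_def)
      then show ?thesis
        using ef(1,3) unfolding eventually_at by (metis min_less_iff_conj)
    qed
    then have "velocity (x i) s = velocity (x i) t" if "s \<in> {a<..<b}" "t \<in> {a<..<b}" for s t
      using connected_local_const[of "{a<..<b}" s t "velocity (x i)"] that by auto
    then show ?thesis
      unfolding constant_on_def by metis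
  qed
  fix t i j assume ij: "i < n" "j < n" and imp: "impact n x i j t"
  then have tch: "touching x i j t"
    by (simp add: impact_def)
  then have ne: "i \<noteq> j"
    by (auto simp: touching_def)
  show "velocity (x i) t = velocity_before (x i) t -
      proj (x i t - x j t) (velocity_before (x i) t - velocity_before (x j) t)"
    using touching_hit(3)[OF ij tch ij(1)] by (simp add: collide_def)
  show "velocity (x j) t = velocity_before (x j) t -
      proj (x i t - x j t) (velocity_before (x j) t - velocity_before (x i) t)"
    using touching_hit(3)[OF ij tch ij(2)] ne by (simp add: collide_def)
qed

text \<open>The normal component of the relative velocity is negative before and positive after the
  contact, so the distance exceeds 2 on both sides for as long as the two motions stay
  linear.\<close>

lemma touching_isolated:
  assumes ij: "i < n" "j < n" "touching x i j t"
  shows "\<exists>\<epsilon>>0. \<forall>s \<in> {t - \<epsilon><..<t} \<union> {t<..<t + \<epsilon>}. \<not> touching x i j s"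
proof -
  define w where "w = x i t - x j t"
  define b a where "b = velocity_before (x i) t - velocity_before (x j) t"
    and "a = velocity (x i) t - velocity (x j) t"
  have ne: "i \<noteq> j" and w2: "norm w = 2"
    using ij(3) by (auto simp: touching_def w_def)
  then have w0: "w \<noteq> 0" by auto
  have b: "w \<bullet> b < 0"
    using touching_hit(2)[OF ij] by (simp add: w_def b_def inner_commute)
  have "a = b - 2 *\<^sub>R proj w b"
    using touching_hit(3)[OF ij ij(1)] touching_hit(3)[OF ij ij(2)] ne proj_minus[of w b]
    by (simp add: collide_def a_def b_def w_def algebra_simps scaleR_2)
  then have a: "w \<bullet> a > 0"
    using b inner_proj[OF w0, of b] by (simp add: inner_diff_right inner_commute)
  obtain e where e: "e > 0" "\<forall>s. t - e \<le> s \<longrightarrow> s \<le> t \<longrightarrow> x i s = x i t + (s - t) *\<^sub>R velocity_before (x i) t"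
      "\<forall>s. t \<le> s \<longrightarrow> s \<le> t + e \<longrightarrow> x i s = x i t + (s - t) *\<^sub>R velocity (x i) t"
    using kink_ex[OF ij(1), of t] unfolding kink_def by (elim exE conjE)
  obtain f where f: "f > 0" "\<forall>s. t - f \<le> s \<longrightarrow> s \<le> t \<longrightarrow> x j s = x j t + (s - t) *\<^sub>R velocity_before (x j) t"
      "\<forall>s. t \<le> s \<longrightarrow> s \<le> t + f \<longrightarrow> x j s = x j t + (s - t) *\<^sub>R velocity (x j) t"
    using kink_ex[OF ij(2), of t] unfolding kink_def by (elim exE conjE)
  have "norm (x i s - x j s) > 2" if "t - min e f < s" "s < t" for s
  proof -
    have "x i s - x j s = w + (s - t) *\<^sub>R b"
      using e(2)[rule_format, of s] f(2)[rule_format, of s] that by (simp add: w_def b_def algebra_simps)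
    then show ?thesis
      using norm_approach_strict[OF b, of "s - t"] that w2 by simp
  qed
  moreover have "norm (x i s - x j s) > 2" if "t < s" "s < t + min e f" for s
  proof -
    have "x i s - x j s = w + (t - s) *\<^sub>R (- a)"
      using e(3)[rule_format, of s] f(3)[rule_format, of s] that by (simp add: w_def a_def algebra_simps)
    then show ?thesis
      using norm_approach_strict[of w "- a" "t - s"] a that w2 by simp
  qed
  ultimately show ?thesis
    using e(1) f(1) by (intro exI[of _ "min e f"]) (force simp: touching_def)
qed

lemma collision_of_touching:
  assumes ij: "i < n" "j < n" "i < j" "touching x i j t"
  shows "(i, j, midpoint (x i t) (x j t), t) \<in> collisions n x"
proof -
  define w where "w = x i t - x j t"
  define b where "b = velocity_before (x i) t - velocity_before (x j) t"
  have w0: "w \<noteq> 0"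
    using ij(4) by (auto simp: touching_def w_def)
  have "b \<bullet> w < 0"
    using touching_hit(2)[OF ij(1,2,4)] by (simp add: w_def b_def)
  then have "proj w b \<noteq> 0"
    using inner_proj[OF w0, of b] by auto
  then have "velocity (x i) t \<noteq> velocity_before (x i) t" "velocity (x j) t \<noteq> velocity_before (x j) t"
    using touching_hit(3)[OF ij(1,2,4) ij(1)] touching_hit(3)[OF ij(1,2,4) ij(2)] ij(3) proj_minus[of w b]
    by (auto simp: collide_def w_def b_def)
  then show ?thesis
    using touching_isolated[OF ij(1,2,4)] ij by (simp add: collisions_def)
qed

text \<open>Projecting collisions to their times can only lose elements, and each contact time is
  the time of some collision.\<close>

lemma ecard_collisions:
  assumes "finite C" "C \<subseteq> contact_times 2 n x"
  shows "enat (card C) \<le> ecard (collisions n x)"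
proof (cases "finite (collisions n x)")
  case True
  have "\<exists>i j y. (i, j, y, t) \<in> collisions n x" if "t \<in> C" for t
  proof -
    obtain i j where "i < n" "j < n" "i \<noteq> j" "touching x i j t"
      using assms(2) \<open>t \<in> C\<close> by (auto simp: contact_times_def touching_def)
    then show ?thesis
      using collision_of_touching[of i j t] collision_of_touching[of j i t]
      by (cases "i < j") (auto simp: touching_def norm_minus_commute)
  qed
  then have "C \<subseteq> (\<lambda>(i, j, y, t). t) ` collisions n x"
    by force
  then have "card C \<le> card ((\<lambda>(i, j, y, t). t) ` collisions n x)"
    using True by (intro card_mono) auto
  also have "\<dots> \<le> card (collisions n x)"
    using True by (rule card_image_le)
  finally show ?thesis
    using True by (simp add: ecard_def)
qed (simp add: ecard_def)

end

section \<open>Aiming the relay\<close>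

text \<open>Ball 0 is reserved for the fast ball; \<open>P k i\<close> and \<open>V k i\<close>
  describe the lines of the balls 1 to \<open>n\<close> in the \<open>k\<close>-th motion. In the
  limit the fast point starts at \<open>- D\<close> with speed \<open>U\<close> and meets point
  \<open>i\<close> at time \<open>s i\<close>.\<close>

locale relay =
  fixes n :: nat and b :: "'a::euclidean_space" and X A s :: "nat \<Rightarrow> real" and U D :: real
    and \<delta> :: "nat \<Rightarrow> real" and P V :: "nat \<Rightarrow> nat \<Rightarrow> 'a"
  assumes b: "norm b = 1"
    and lim_P: "\<And>i. 1 \<le> i \<Longrightarrow> i \<le> n \<Longrightarrow> (\<lambda>k. P k i) \<longlonglongrightarrow> X i *\<^sub>R b"
    and lim_V: "\<And>i. 1 \<le> i \<Longrightarrow> i \<le> n \<Longrightarrow> (\<lambda>k. V k i) \<longlonglongrightarrow> A i *\<^sub>R b"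
    and lim_\<delta>: "\<delta> \<longlonglongrightarrow> 0"
    and X_less: "\<And>i l. 1 \<le> i \<Longrightarrow> i < l \<Longrightarrow> l \<le> n \<Longrightarrow> X i < X l"
    and A_less: "\<And>i l. 1 \<le> i \<Longrightarrow> i < l \<Longrightarrow> l \<le> n \<Longrightarrow> A i < A l"
    and A_less_U: "\<And>i. 1 \<le> i \<Longrightarrow> i \<le> n \<Longrightarrow> A i < U"
    and s_0: "s 0 = 0"
    and s_less_Suc: "\<And>i. i < n \<Longrightarrow> s i < s (Suc i)"
    and meet: "\<And>i. 1 \<le> i \<Longrightarrow> i \<le> n \<Longrightarrow> X i + A i * s i = U * s i - D"
begin

lemma bb: "b \<bullet> b = 1"
  using b by (simp add: norm_eq_1)

lemma s_less: "i < l \<Longrightarrow> l \<le> n \<Longrightarrow> s i < s l"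
proof (induction l)
  case (Suc l)
  then show ?case
    using s_less_Suc[of l] by (cases "i = l") auto
qed simp

lemma s_le: "i \<le> l \<Longrightarrow> l \<le> n \<Longrightarrow> s i \<le> s l"
  using s_less[of i l] by (cases "i = l") auto

text \<open>Impact \<open>j\<close> is ball \<open>j - 1\<close> hitting ball \<open>j\<close> at
  time \<open>\<sigma> k j\<close>; \<open>e k j\<close> points from the hitting centre to the hit
  one, and \<open>l k j\<close> is the speed handed over in this direction. The relations say that
  ball \<open>j\<close>, having received it, flies to its impact on ball \<open>j + 1\<close> and
  hands over \<open>l k (Suc j)\<close> there. The induction runs downwards because impact
  \<open>j + 1\<close> determines impact \<open>j\<close>.\<close>

lemma backward_aim:
  assumes "1 \<le> m" "m \<le> n"
  shows "\<exists>\<sigma> e l. (\<forall>j\<in>{m..n}. (\<lambda>k. \<sigma> k j) \<longlonglongrightarrow> s j \<and> (\<lambda>k. e k j) \<longlonglongrightarrow> b \<and>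
        (\<lambda>k. l k j) \<longlonglongrightarrow> U - A j \<and> (\<forall>\<^sub>F k in sequentially. norm (e k j) = 1)) \<and>
     (\<forall>j\<in>{m..<n}. \<forall>\<^sub>F k in sequentially.
        (V k j + l k j *\<^sub>R e k j - V k (Suc j)) \<bullet> e k (Suc j) = l k (Suc j) \<and>
        P k j + \<sigma> k j *\<^sub>R V k j + (\<sigma> k (Suc j) - \<sigma> k j) *\<^sub>R (V k j + l k j *\<^sub>R e k j)
          + \<delta> k *\<^sub>R e k (Suc j) = P k (Suc j) + \<sigma> k (Suc j) *\<^sub>R V k (Suc j))"
  using assms(2,1)
proof (induction rule: inc_induct)
  case base
  \<comment> \<open>The last impact may be prescribed freely; it is taken to be that of the limiting
    points.\<close>
  show ?case
    by (intro exI[of _ "\<lambda>k. s"] exI[of _ "\<lambda>k j. b"] exI[of _ "\<lambda>k j. U - A j"]) (simp add: b)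
next
  case (step m)
  then obtain \<sigma> :: "nat \<Rightarrow> nat \<Rightarrow> real" and e l where
    IH: "\<forall>j\<in>{Suc m..n}. (\<lambda>k. \<sigma> k j) \<longlonglongrightarrow> s j \<and> (\<lambda>k. e k j) \<longlonglongrightarrow> b \<and>
        (\<lambda>k. l k j) \<longlonglongrightarrow> U - A j \<and> (\<forall>\<^sub>F k in sequentially. norm (e k j) = 1)"
    "\<forall>j\<in>{Suc m..<n}. \<forall>\<^sub>F k in sequentially.
        (V k j + l k j *\<^sub>R e k j - V k (Suc j)) \<bullet> e k (Suc j) = l k (Suc j) \<and>
        P k j + \<sigma> k j *\<^sub>R V k j + (\<sigma> k (Suc j) - \<sigma> k j) *\<^sub>R (V k j + l k j *\<^sub>R e k j)
          + \<delta> k *\<^sub>R e k (Suc j) = P k (Suc j) + \<sigma> k (Suc j) *\<^sub>R V k (Suc j)"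
    by fastforce
  define M where "M = Suc m"
  have m: "1 \<le> m" "m \<le> n" "m < n" and M: "1 \<le> M" "M \<le> n" "m < M"
    using step.hyps step.prems by (auto simp: M_def)
  have IHM: "(\<lambda>k. \<sigma> k M) \<longlonglongrightarrow> s M" "(\<lambda>k. e k M) \<longlonglongrightarrow> b" "(\<lambda>k. l k M) \<longlonglongrightarrow> U - A M"
      "\<forall>\<^sub>F k in sequentially. norm (e k M) = 1"
    using IH(1) M by (auto simp: M_def)
  \<comment> \<open>Ball \<open>m\<close> must fly from its own line at time \<open>\<tau> k\<close>
    to the contact position at time \<open>\<sigma> k M\<close>, with some velocity
    \<open>g k\<close> such that \<open>(g k - V k M) \<bullet> e k M = l k M\<close>. Multiplied by
    the time of flight, this becomes linear in \<open>\<tau> k\<close>, with coefficient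
    \<open>den k\<close>.\<close>
  define den where "den k = l k M + (V k M - V k m) \<bullet> e k M" for k
  define \<tau> where "\<tau> k = (l k M * \<sigma> k M + \<delta> k - (P k M - P k m) \<bullet> e k M) / den k" for k
  define g where "g k = (1 / (\<sigma> k M - \<tau> k)) *\<^sub>R
      (P k M + \<sigma> k M *\<^sub>R V k M - \<delta> k *\<^sub>R e k M - (P k m + \<tau> k *\<^sub>R V k m))" for k
  \<comment> \<open>Impact \<open>m\<close> has to turn \<open>V k m\<close> into
    \<open>g k\<close>. So the transferred speed and the direction are the length and the direction
    of the difference.\<close>
  define r where "r k = norm (g k - V k m)" for k
  define f where "f k = (1 / r k) *\<^sub>R (g k - V k m)" for k
  note PM = lim_P[OF M(1,2)] and Pm = lim_P[OF m(1,2)] and VM = lim_V[OF M(1,2)] and Vm = lim_V[OF m(1,2)]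
  have UA: "0 < U - A m"
    using A_less_U m by simp
  have s: "s m < s M"
    using s_less M by simp
  have den: "den \<longlonglongrightarrow> U - A m"
    unfolding den_def
    by (rule tendsto_eq_rhs[OF tendsto_add[OF IHM(3) tendsto_inner[OF tendsto_diff[OF VM Vm] IHM(2)]]])
       (simp add: bb inner_diff_left)
  have \<tau>: "\<tau> \<longlonglongrightarrow> s m"
    unfolding \<tau>_def
  proof (rule tendsto_eq_rhs[OF tendsto_divide[OF tendsto_diff[OF
          tendsto_add[OF tendsto_mult[OF IHM(3,1)] lim_\<delta>] tendsto_inner[OF tendsto_diff[OF PM Pm] IHM(2)]] den]])
    have "((U - A M) * s M + 0 - (X M *\<^sub>R b - X m *\<^sub>R b) \<bullet> b) = (U - A m) * s m"
      using meet[OF m(1,2)] meet[OF M(1,2)] by (simp add: bb inner_diff_left algebra_simps)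
    then show "((U - A M) * s M + 0 - (X M *\<^sub>R b - X m *\<^sub>R b) \<bullet> b) / (U - A m) = s m"
      using UA by simp
  qed (use UA in auto)
  have g: "g \<longlonglongrightarrow> U *\<^sub>R b"
    unfolding g_def
  proof (rule tendsto_eq_rhs[OF tendsto_scaleR[OF tendsto_divide[OF tendsto_const tendsto_diff[OF IHM(1) \<tau>]]
          tendsto_diff[OF tendsto_diff[OF tendsto_add[OF PM tendsto_scaleR[OF IHM(1) VM]]
              tendsto_scaleR[OF lim_\<delta> IHM(2)]] tendsto_add[OF Pm tendsto_scaleR[OF \<tau> Vm]]]]])
    have "X M *\<^sub>R b + s M *\<^sub>R (A M *\<^sub>R b) - 0 *\<^sub>R b - (X m *\<^sub>R b + s m *\<^sub>R (A m *\<^sub>R b))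
       = ((X M + A M * s M) - (X m + A m * s m)) *\<^sub>R b"
      by (simp add: algebra_simps)
    also have "(X M + A M * s M) - (X m + A m * s m) = (s M - s m) * U"
      unfolding meet[OF m(1,2)] meet[OF M(1,2)] by (simp add: algebra_simps)
    finally show "(1 / (s M - s m)) *\<^sub>R
        (X M *\<^sub>R b + s M *\<^sub>R (A M *\<^sub>R b) - 0 *\<^sub>R b - (X m *\<^sub>R b + s m *\<^sub>R (A m *\<^sub>R b))) = U *\<^sub>R b"
      using s by simp
  qed (use s in auto)
  have r: "r \<longlonglongrightarrow> U - A m"
    unfolding r_def
    by (rule tendsto_eq_rhs[OF tendsto_norm[OF tendsto_diff[OF g Vm]]])
       (use UA b in \<open>simp add: scaleR_left_diff_distrib[symmetric]\<close>)
  have f: "f \<longlonglongrightarrow> b"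
    unfolding f_def
    by (rule tendsto_eq_rhs[OF tendsto_scaleR[OF tendsto_divide[OF tendsto_const r] tendsto_diff[OF g Vm]]])
       (use UA in \<open>auto simp: scaleR_left_diff_distrib[symmetric]\<close>)
  have ev: "\<forall>\<^sub>F k in sequentially. 0 < r k" "\<forall>\<^sub>F k in sequentially. 0 < den k"
      "\<forall>\<^sub>F k in sequentially. 0 < \<sigma> k M - \<tau> k"
    using order_tendstoD(1)[OF r UA] order_tendstoD(1)[OF den UA]
      order_tendstoD(1)[OF tendsto_diff[OF IHM(1) \<tau>], of 0] s by auto
  have nf: "\<forall>\<^sub>F k in sequentially. norm (f k) = 1"
    using ev(1) by eventually_elim (simp add: f_def r_def)
  have rel: "\<forall>\<^sub>F k in sequentially. (V k m + r k *\<^sub>R f k - V k M) \<bullet> e k M = l k M \<and>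
      P k m + \<tau> k *\<^sub>R V k m + (\<sigma> k M - \<tau> k) *\<^sub>R (V k m + r k *\<^sub>R f k) + \<delta> k *\<^sub>R e k M
        = P k M + \<sigma> k M *\<^sub>R V k M"
    using ev IHM(4)
  proof eventually_elim
    case (elim k)
    have gf: "V k m + r k *\<^sub>R f k = g k"
      using elim(1) by (simp add: f_def)
    have g: "(\<sigma> k M - \<tau> k) *\<^sub>R g k
        = P k M + \<sigma> k M *\<^sub>R V k M - \<delta> k *\<^sub>R e k M - (P k m + \<tau> k *\<^sub>R V k m)"
      using elim(3) by (simp add: g_def)
    have ee: "e k M \<bullet> e k M = 1"
      using elim(4) by (simp add: norm_eq_1)
    have \<tau>: "\<tau> k * den k = l k M * \<sigma> k M + \<delta> k - (P k M - P k m) \<bullet> e k M"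
      using elim(2) by (simp add: \<tau>_def)
    \<comment> \<open>The equation that defines \<open>\<tau> k\<close>, still multiplied by the
      positive time of flight.\<close>
    have "(\<sigma> k M - \<tau> k) * ((g k - V k M) \<bullet> e k M)
        = ((\<sigma> k M - \<tau> k) *\<^sub>R g k) \<bullet> e k M - (\<sigma> k M - \<tau> k) * (V k M \<bullet> e k M)"
      by (simp add: inner_diff_left algebra_simps)
    also have "\<dots> = (\<sigma> k M - \<tau> k) * l k M"
      unfolding g using \<tau> ee
      by (simp add: inner_diff_left inner_add_left den_def algebra_simps)
    finally have "(g k - V k M) \<bullet> e k M = l k M"
      using elim(3) by simp
    then show ?case
      unfolding gf using g by simp
  qed
  define \<sigma>' where "\<sigma>' k j = (if j = m then \<tau> k else \<sigma> k j)" for k j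
  define e' where "e' k j = (if j = m then f k else e k j)" for k j
  define l' where "l' k j = (if j = m then r k else l k j)" for k j
  have "(\<lambda>k. \<sigma>' k j) \<longlonglongrightarrow> s j \<and> (\<lambda>k. e' k j) \<longlonglongrightarrow> b \<and>
        (\<lambda>k. l' k j) \<longlonglongrightarrow> U - A j \<and> (\<forall>\<^sub>F k in sequentially. norm (e' k j) = 1)"
    if "j \<in> {m..n}" for j
    using IH(1) that \<tau> f r nf by (cases "j = m") (auto simp: \<sigma>'_def e'_def l'_def)
  moreover have "\<forall>\<^sub>F k in sequentially.
        (V k j + l' k j *\<^sub>R e' k j - V k (Suc j)) \<bullet> e' k (Suc j) = l' k (Suc j) \<and>
        P k j + \<sigma>' k j *\<^sub>R V k j + (\<sigma>' k (Suc j) - \<sigma>' k j) *\<^sub>R (V k j + l' k j *\<^sub>R e' k j)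
          + \<delta> k *\<^sub>R e' k (Suc j) = P k (Suc j) + \<sigma>' k (Suc j) *\<^sub>R V k (Suc j)"
    if "j \<in> {m..<n}" for j
  proof (cases "j = m")
    case True
    then show ?thesis
      using rel by (simp add: \<sigma>'_def e'_def l'_def M_def)
  next
    case False
    then have "j \<in> {Suc m..<n}"
      using that by auto
    then show ?thesis
      using bspec[OF IH(2), of j] by (simp add: \<sigma>'_def e'_def l'_def)
  qed
  ultimately show ?case
    by (intro exI[of _ \<sigma>'] exI[of _ e'] exI[of _ l']) blast
qed

text \<open>Extends the aim back to ball 0 at time 0. \<open>F k j\<close> is the velocity of ball
  \<open>j\<close> while it is the fast one, and \<open>C k j\<close> is its centre when it becomes
  so, that is at time 0 for \<open>j = 0\<close> and at impact \<open>j\<close> otherwise.\<close>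

lemma forward_aim:
  assumes "1 \<le> n"
  obtains \<sigma> e l F C where
    "\<And>j. j \<le> n \<Longrightarrow> (\<lambda>k. \<sigma> k j) \<longlonglongrightarrow> s j" "\<And>k. \<sigma> k 0 = 0"
    "\<And>j. 1 \<le> j \<Longrightarrow> j \<le> n \<Longrightarrow> (\<lambda>k. e k j) \<longlonglongrightarrow> b"
    "\<And>j. 1 \<le> j \<Longrightarrow> j \<le> n \<Longrightarrow> (\<lambda>k. l k j) \<longlonglongrightarrow> U - A j"
    "\<And>j. 1 \<le> j \<Longrightarrow> j \<le> n \<Longrightarrow> \<forall>\<^sub>F k in sequentially. norm (e k j) = 1"
    "\<And>j. j \<le> n \<Longrightarrow> (\<lambda>k. F k j) \<longlonglongrightarrow> U *\<^sub>R b"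
    "\<And>j. j \<le> n \<Longrightarrow> (\<lambda>k. C k j) \<longlonglongrightarrow> (U * s j - D) *\<^sub>R b"
    "\<And>k j. 1 \<le> j \<Longrightarrow> F k j = V k j + l k j *\<^sub>R e k j"
    "\<And>k j. 1 \<le> j \<Longrightarrow> C k j = P k j + \<sigma> k j *\<^sub>R V k j"
    "\<And>j. j < n \<Longrightarrow> \<forall>\<^sub>F k in sequentially. (F k j - V k (Suc j)) \<bullet> e k (Suc j) = l k (Suc j)"
    "\<And>j. j < n \<Longrightarrow> \<forall>\<^sub>F k in sequentially.
        C k j + (\<sigma> k (Suc j) - \<sigma> k j) *\<^sub>R F k j + \<delta> k *\<^sub>R e k (Suc j) = C k (Suc j)"
proof -
  obtain \<sigma> :: "nat \<Rightarrow> nat \<Rightarrow> real" and e l where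
    A: "\<forall>j\<in>{1..n}. (\<lambda>k. \<sigma> k j) \<longlonglongrightarrow> s j \<and> (\<lambda>k. e k j) \<longlonglongrightarrow> b \<and>
        (\<lambda>k. l k j) \<longlonglongrightarrow> U - A j \<and> (\<forall>\<^sub>F k in sequentially. norm (e k j) = 1)"
    "\<forall>j\<in>{1..<n}. \<forall>\<^sub>F k in sequentially.
        (V k j + l k j *\<^sub>R e k j - V k (Suc j)) \<bullet> e k (Suc j) = l k (Suc j) \<and>
        P k j + \<sigma> k j *\<^sub>R V k j + (\<sigma> k (Suc j) - \<sigma> k j) *\<^sub>R (V k j + l k j *\<^sub>R e k j)
          + \<delta> k *\<^sub>R e k (Suc j) = P k (Suc j) + \<sigma> k (Suc j) *\<^sub>R V k (Suc j)"
    using backward_aim[of 1] assms by auto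
  have lim: "(\<lambda>k. \<sigma> k j) \<longlonglongrightarrow> s j" "(\<lambda>k. e k j) \<longlonglongrightarrow> b" "(\<lambda>k. l k j) \<longlonglongrightarrow> U - A j"
     "\<forall>\<^sub>F k in sequentially. norm (e k j) = 1" if "1 \<le> j" "j \<le> n" for j
    using A(1) that by auto
  define \<sigma>' where "\<sigma>' k j = (if j = 0 then 0 else \<sigma> k j)" for k j
  \<comment> \<open>For \<open>j = 0\<close> the index \<open>max 1 j\<close> gives ball 0 the
    velocity that ball 1 is to take over. The velocities then differ by
    \<open>l k 1 *\<^sub>R e k 1\<close>, so the first impact exchanges them completely. The centre
    \<open>C k 0\<close> is found by flying back from this impact to time 0.\<close>
  define F where "F k j = V k (max 1 j) + l k (max 1 j) *\<^sub>R e k (max 1 j)" for k j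
  define C where "C k j = (if j = 0 then P k 1 + \<sigma> k 1 *\<^sub>R V k 1 - \<delta> k *\<^sub>R e k 1 - \<sigma> k 1 *\<^sub>R F k 0
     else P k j + \<sigma> k j *\<^sub>R V k j)" for k j
  have limF: "(\<lambda>k. F k j) \<longlonglongrightarrow> U *\<^sub>R b" if "j \<le> n" for j
    unfolding F_def using that assms
    by (intro tendsto_eq_rhs[OF tendsto_add[OF lim_V tendsto_scaleR[OF lim(3,2)]]])
       (auto simp: algebra_simps)
  have limC: "(\<lambda>k. C k j) \<longlonglongrightarrow> (U * s j - D) *\<^sub>R b" if j: "j \<le> n" for j
  proof -
    have c: "(\<lambda>k. P k j + \<sigma> k j *\<^sub>R V k j) \<longlonglongrightarrow> (U * s j - D) *\<^sub>R b" if "1 \<le> j" "j \<le> n" for j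
      by (rule tendsto_eq_rhs[OF tendsto_add[OF lim_P[OF that] tendsto_scaleR[OF lim(1)[OF that] lim_V[OF that]]]])
         (simp flip: meet[OF that] add: algebra_simps)
    show ?thesis
    proof (cases "j = 0")
      case True
      have "(\<lambda>k. C k 0) \<longlonglongrightarrow> (U * s 1 - D) *\<^sub>R b - 0 *\<^sub>R b - s 1 *\<^sub>R (U *\<^sub>R b)"
        using tendsto_diff[OF tendsto_diff[OF c[OF order_refl assms]
            tendsto_scaleR[OF lim_\<delta> lim(2)[OF order_refl assms]]]
            tendsto_scaleR[OF lim(1)[OF order_refl assms] limF[of 0]]]
        by (simp add: C_def)
      then show ?thesis
        using True by (simp add: s_0 algebra_simps)
    next
      case False
      then show ?thesis
        using c[of j] j by (simp add: C_def)
    qed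
  qed
  show thesis
  proof (rule that[of \<sigma>' e l F C])
    show "(\<lambda>k. \<sigma>' k j) \<longlonglongrightarrow> s j" if "j \<le> n" for j
      using lim(1)[of j] that by (cases "j = 0") (auto simp: \<sigma>'_def s_0)
    show "\<forall>\<^sub>F k in sequentially. (F k j - V k (Suc j)) \<bullet> e k (Suc j) = l k (Suc j)" if "j < n" for j
    proof (cases "j = 0")
      case True
      then show ?thesis
        using lim(4)[of 1] assms by (auto elim!: eventually_mono simp: F_def norm_eq_1)
    next
      case False
      then have j: "j \<in> {1..<n}" using that by auto
      show ?thesis
        by (rule eventually_mono[OF bspec[OF A(2) j]]) (use j in \<open>simp add: F_def max_def\<close>)
    qed
    show "\<forall>\<^sub>F k in sequentially.
        C k j + (\<sigma>' k (Suc j) - \<sigma>' k j) *\<^sub>R F k j + \<delta> k *\<^sub>R e k (Suc j) = C k (Suc j)" if "j < n" for j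
    proof (cases "j = 0")
      case True
      then show ?thesis
        by (simp add: C_def \<sigma>'_def)
    next
      case False
      then have j: "j \<in> {1..<n}" using that by auto
      show ?thesis
        by (rule eventually_mono[OF bspec[OF A(2) j]])
           (use j in \<open>auto simp: F_def C_def \<sigma>'_def max_def\<close>)
    qed
  qed (use lim limF limC in \<open>auto simp: F_def C_def \<sigma>'_def max_def\<close>)
qed

end

text \<open>The component of the difference along the unit vector \<open>z\<close> is affine in
  time, hence smallest at an end of the interval, and it bounds the distance from below. A single
  direction thus certifies a whole time interval.\<close>

lemma segment_far:
  fixes p v q u z :: "'a::euclidean_space"
  assumes z: "norm z = 1" and r: "s \<le> r" "r \<le> t"
    and sep: "\<delta> < (p + s *\<^sub>R v - (q + s *\<^sub>R u)) \<bullet> z" "\<delta> < (p + t *\<^sub>R v - (q + t *\<^sub>R u)) \<bullet> z"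
  shows "\<delta> < norm (p + r *\<^sub>R v - (q + r *\<^sub>R u))"
proof -
  define f where "f x = (p + x *\<^sub>R v - (q + x *\<^sub>R u)) \<bullet> z" for x
  have f: "f x = f y + (x - y) * ((v - u) \<bullet> z)" for x y
    by (simp add: f_def inner_diff_left inner_add_left algebra_simps)
  have "\<delta> < f r"
  proof (cases "0 \<le> (v - u) \<bullet> z")
    case True
    then have "0 \<le> (r - s) * ((v - u) \<bullet> z)"
      using r(1) by simp
    then show ?thesis
      using sep(1) f[of r s] by (simp add: f_def[symmetric])
  next
    case False
    then have "0 \<le> (r - t) * ((v - u) \<bullet> z)"
      using r(2) by (intro mult_nonpos_nonpos) auto
    then show ?thesis
      using sep(2) f[of r t] by (simp add: f_def[symmetric])
  qed
  also have "f r \<le> norm (p + r *\<^sub>R v - (q + r *\<^sub>R u))"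
    using norm_cauchy_schwarz[of "p + r *\<^sub>R v - (q + r *\<^sub>R u)" z] z by (simp add: f_def)
  finally show ?thesis .
qed

lemma apart_except_segment:
  fixes p v :: "nat \<Rightarrow> 'a::euclidean_space"
  assumes b: "norm b = 1" and r: "s \<le> r" "r \<le> t"
    and sep: "\<And>k l. k < l \<Longrightarrow> l < m \<Longrightarrow> \<not> (k = i \<and> l = j) \<Longrightarrow> \<delta> < (p l + s *\<^sub>R v l - (p k + s *\<^sub>R v k)) \<bullet> b"
      "\<And>k l. k < l \<Longrightarrow> l < m \<Longrightarrow> \<not> (k = i \<and> l = j) \<Longrightarrow> \<delta> < (p l + t *\<^sub>R v l - (p k + t *\<^sub>R v k)) \<bullet> b"
  shows "apart_except \<delta> m i j (\<lambda>k. p k + r *\<^sub>R v k)"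
  unfolding apart_except_def
proof (intro allI impI)
  fix k l assume kl: "k < m" "l < m" "k \<noteq> l" "{k, l} \<noteq> {i, j}"
  show "\<delta> < norm (p k + r *\<^sub>R v k - (p l + r *\<^sub>R v l))"
  proof (cases "k < l")
    case True
    have "\<not> (k = i \<and> l = j)" using kl(4) by auto
    then show ?thesis
      using segment_far[OF b r sep(1)[OF True kl(2)] sep(2)[OF True kl(2)]] by (simp add: norm_minus_commute)
  next
    case False
    then have "l < k" "\<not> (l = i \<and> k = j)" using kl(3,4) by auto
    then show ?thesis
      using segment_far[OF b r sep(1)[OF _ kl(1)] sep(2)[OF _ kl(1)]] by blast
  qed
qed

section \<open>The limiting points on the line, and the relay itself\<close>

context relay
begin

text \<open>In the limit the balls become points on the line, and a collision merely exchanges two labels: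
  every ball moves along one of the unperturbed lines.  After \<open>j\<close> collisions of the relay, ball \<open>j\<close> is on
  the fast line.\<close>

definition slope :: "nat \<Rightarrow> nat \<Rightarrow> real" where
  "slope j i = (if i < j then A (Suc i) else if i = j then U else A i)"

definition offset :: "nat \<Rightarrow> nat \<Rightarrow> real" where
  "offset j i = (if i < j then X (Suc i) else if i = j then - D else X i)"

lemma ghost_less:
  assumes "1 \<le> i" "i < l" "l \<le> n" "0 \<le> t"
  shows "X i + t * A i < X l + t * A l"
  using X_less[OF assms(1-3)] mult_left_mono[OF less_imp_le[OF A_less[OF assms(1-3)]] assms(4)]
  by linarith

lemma ghost_fast:
  assumes "1 \<le> i" "i \<le> n"
  shows "X i + t * A i - (- D + t * U) = (U - A i) * (s i - t)"
  using meet[OF assms] by (simp add: algebra_simps)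

lemma ghost_less_fast:
  assumes "1 \<le> i" "i \<le> n" "s i < t"
  shows "X i + t * A i < - D + t * U"
proof -
  have "(U - A i) * (s i - t) < 0"
    using A_less_U[OF assms(1,2)] assms(3) by (intro mult_pos_neg) auto
  then show ?thesis
    using ghost_fast[OF assms(1,2), of t] by linarith
qed

lemma fast_less_ghost:
  assumes "1 \<le> i" "i \<le> n" "t < s i"
  shows "- D + t * U < X i + t * A i"
proof -
  have "(U - A i) * (s i - t) > 0"
    using A_less_U[OF assms(1,2)] assms(3) by (intro mult_pos_pos) auto
  then show ?thesis
    using ghost_fast[OF assms(1,2), of t] by linarith
qed

text \<open>The slow lines never cross after time 0, as \<open>X\<close> and \<open>A\<close> both
  increase, and the fast line crosses line \<open>i\<close> exactly at \<open>s i\<close>. The two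
  excluded cases are the impacts at the two ends of the phase, where the limiting points of the
  colliding balls coincide.\<close>

lemma order_at:
  assumes il: "i < l" "l \<le> n" and j: "j \<le> n" and t: "s j \<le> t" "j < n \<Longrightarrow> t \<le> s (Suc j)"
    and ne: "\<not> (Suc i = j \<and> l = j \<and> t = s j)" "\<not> (i = j \<and> l = Suc j \<and> t = s (Suc j))"
  shows "offset j i + t * slope j i < offset j l + t * slope j l"
proof -
  have t0: "0 \<le> t"
    using s_le[of 0 j] s_0 j t(1) by simp
  consider "l < j" | "l = j" | "i < j" "j < l" | "i = j" | "j < i"
    using il by linarith
  then show ?thesis
  proof cases
    case 1
    then show ?thesis
      using ghost_less[of "Suc i" "Suc l" t] il j t0 by (simp add: slope_def offset_def)
  next
    case 2
    have "s (Suc i) < t"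
    proof (cases "Suc i = j")
      case True
      then show ?thesis using ne(1) 2 t(1) by force
    next
      case False
      then show ?thesis using s_less[of "Suc i" j] 2 il(1) j t(1) by force
    qed
    then show ?thesis
      using ghost_less_fast[of "Suc i" t] 2 il by (simp add: slope_def offset_def)
  next
    case 3
    then show ?thesis
      using ghost_less[of "Suc i" l t] il t0 by (simp add: slope_def offset_def)
  next
    case 4
    have "t < s l"
    proof (cases "l = Suc j")
      case True
      then show ?thesis using ne(2) 4 t(2) il by force
    next
      case False
      then show ?thesis using s_less[of "Suc j" l] 4 il t(2) by force
    qed
    then show ?thesis
      using fast_less_ghost[of l t] 4 il by (simp add: slope_def offset_def)
  next
    case 5
    then show ?thesis
      using ghost_less[of i l t] il t0 by (simp add: slope_def offset_def)
  qed
qed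

lemma cascade:
  assumes n: "1 \<le> n"
    and R: "\<forall>\<^sub>F k in sequentially. 0 < \<delta> k \<and> reach (\<delta> k) n N W0 0 (\<lambda>i. P k (Suc i)) (\<lambda>i. V k (Suc i))"
    and W0: "W0 < U" and W: "U < W" "\<And>i. 1 \<le> i \<Longrightarrow> i \<le> n \<Longrightarrow> \<bar>A i\<bar> < W" "0 \<le> U"
  shows "\<exists>p v. (\<forall>i\<le>n. (\<lambda>k. p k i) \<longlonglongrightarrow> (offset n i + (s n + 1) * slope n i) *\<^sub>R b \<and>
                     (\<lambda>k. v k i) \<longlonglongrightarrow> slope n i *\<^sub>R b) \<and>
     (\<forall>\<^sub>F k in sequentially. reach (\<delta> k) (Suc n) (N + n) W 0 (p k) (v k))"
proof (rule forward_aim[OF n])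
  fix \<sigma> :: "nat \<Rightarrow> nat \<Rightarrow> real" and e l F C
  assume lim_\<sigma>: "\<And>j. j \<le> n \<Longrightarrow> (\<lambda>k. \<sigma> k j) \<longlonglongrightarrow> s j" and \<sigma>_0: "\<And>k. \<sigma> k 0 = 0"
    and lim_e: "\<And>j. 1 \<le> j \<Longrightarrow> j \<le> n \<Longrightarrow> (\<lambda>k. e k j) \<longlonglongrightarrow> b"
    and lim_l: "\<And>j. 1 \<le> j \<Longrightarrow> j \<le> n \<Longrightarrow> (\<lambda>k. l k j) \<longlonglongrightarrow> U - A j"
    and norm_e: "\<And>j. 1 \<le> j \<Longrightarrow> j \<le> n \<Longrightarrow> \<forall>\<^sub>F k in sequentially. norm (e k j) = 1"
    and lim_F: "\<And>j. j \<le> n \<Longrightarrow> (\<lambda>k. F k j) \<longlonglongrightarrow> U *\<^sub>R b"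
    and lim_C: "\<And>j. j \<le> n \<Longrightarrow> (\<lambda>k. C k j) \<longlonglongrightarrow> (U * s j - D) *\<^sub>R b"
    and F: "\<And>k j. 1 \<le> j \<Longrightarrow> F k j = V k j + l k j *\<^sub>R e k j"
    and C: "\<And>k j. 1 \<le> j \<Longrightarrow> C k j = P k j + \<sigma> k j *\<^sub>R V k j"
    and rel1: "\<And>j. j < n \<Longrightarrow> \<forall>\<^sub>F k in sequentially. (F k j - V k (Suc j)) \<bullet> e k (Suc j) = l k (Suc j)"
    and rel2: "\<And>j. j < n \<Longrightarrow> \<forall>\<^sub>F k in sequentially.
        C k j + (\<sigma> k (Suc j) - \<sigma> k j) *\<^sub>R F k j + \<delta> k *\<^sub>R e k (Suc j) = C k (Suc j)"
  \<comment> \<open>The lines followed after \<open>j\<close> impacts of the relay. The positions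
    \<open>pos\<close> are extrapolated to time 0, as \<open>reach\<close> demands.\<close>
  define vel where "vel k j i = (if i < j then F k i - l k (Suc i) *\<^sub>R e k (Suc i)
      else if i = j then F k j else V k i)" for k j i
  define pos where "pos k j i = (if i < j then C k (Suc i) - \<delta> k *\<^sub>R e k (Suc i) - \<sigma> k (Suc i) *\<^sub>R vel k j i
      else if i = j then C k j - \<sigma> k j *\<^sub>R F k j else P k i)" for k j i
  \<comment> \<open>Checkpoints strictly between consecutive limiting impact times. For
    \<open>j = 0\<close> the checkpoint is time 0 itself, where the fast ball is inserted and
    nothing collides.\<close>
  define \<mu> where "\<mu> j = (if j = 0 then 0 else if j < n then (s j + s (Suc j)) / 2 else s j + 1)" for j
  have \<mu>1: "s j \<le> \<mu> j" "j \<noteq> 0 \<Longrightarrow> s j < \<mu> j" and \<mu>2: "j < n \<Longrightarrow> \<mu> j < s (Suc j)" if "j \<le> n" for j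
    using s_less_Suc[of j] that s_0 by (auto simp: \<mu>_def field_simps)
  have lim_vel: "(\<lambda>k. vel k j i) \<longlonglongrightarrow> slope j i *\<^sub>R b" if "i \<le> n" "j \<le> n" for i j
  proof -
    consider "i < j" | "i = j" | "j < i" by linarith
    then show ?thesis
    proof cases
      case 1
      then have "1 \<le> Suc i" "Suc i \<le> n"
        using that by auto
      then show ?thesis
        using tendsto_diff[OF lim_F[OF that(1)] tendsto_scaleR[OF lim_l lim_e], of "Suc i" "Suc i"] 1
        by (simp add: vel_def slope_def algebra_simps)
    qed (use that lim_F lim_V in \<open>auto simp: vel_def slope_def\<close>)
  qed
  have lim_pos: "(\<lambda>k. pos k j i) \<longlonglongrightarrow> offset j i *\<^sub>R b" if ij: "i \<le> n" "j \<le> n" for i j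
  proof -
    consider "i < j" | "i = j" | "j < i" by linarith
    then show ?thesis
    proof cases
      case 1
      then have i: "1 \<le> Suc i" "Suc i \<le> n"
        using that by auto
      have "(U * s (Suc i) - D) *\<^sub>R b - 0 *\<^sub>R b - s (Suc i) *\<^sub>R (slope j i *\<^sub>R b)
          = ((U * s (Suc i) - D) - s (Suc i) * A (Suc i)) *\<^sub>R b"
        using 1 by (simp add: slope_def scaleR_left_diff_distrib)
      also have "(U * s (Suc i) - D) - s (Suc i) * A (Suc i) = offset j i"
        using meet[OF i] 1 by (simp add: offset_def algebra_simps)
      finally show ?thesis
        using tendsto_diff[OF tendsto_diff[OF lim_C[OF i(2)] tendsto_scaleR[OF lim_\<delta> lim_e[OF i]]]
            tendsto_scaleR[OF lim_\<sigma>[OF i(2)] lim_vel[OF ij]]] 1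
        by (simp add: pos_def)
    next
      case 2
      then show ?thesis
        using tendsto_diff[OF lim_C[OF ij(1)] tendsto_scaleR[OF lim_\<sigma>[OF ij(1)] lim_F[OF ij(1)]]]
        by (simp add: pos_def offset_def algebra_simps)
    qed (use that lim_P in \<open>auto simp: pos_def offset_def\<close>)
  qed
  have lim_at: "(\<lambda>k. pos k j i + \<tau> k *\<^sub>R vel k j i) \<longlonglongrightarrow> (offset j i + t * slope j i) *\<^sub>R b"
    if "i \<le> n" "j \<le> n" "\<tau> \<longlonglongrightarrow> t" for i j \<tau> t
    using tendsto_add[OF lim_pos[OF that(1,2)] tendsto_scaleR[OF that(3) lim_vel[OF that(1,2)]]]
    by (simp add: algebra_simps)
  \<comment> \<open>Strict order of the limiting points separates each pair by more than the
    vanishing diameter for large \<open>k\<close>. There are finitely many pairs, so one threshold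
    serves all; the pair \<open>a\<close>, \<open>a'\<close> is the one about to collide or just
    collided.\<close>
  have sep: "\<forall>\<^sub>F k in sequentially. \<forall>i l. i < l \<longrightarrow> l < Suc n \<longrightarrow> \<not> (i = a \<and> l = a') \<longrightarrow>
      \<delta> k < (pos k j l + \<tau> k *\<^sub>R vel k j l - (pos k j i + \<tau> k *\<^sub>R vel k j i)) \<bullet> b"
    if j: "j \<le> n" and \<tau>: "\<tau> \<longlonglongrightarrow> t" and less: "\<And>i l. i < l \<Longrightarrow> l \<le> n \<Longrightarrow> \<not> (i = a \<and> l = a') \<Longrightarrow>
      offset j i + t * slope j i < offset j l + t * slope j l" for j \<tau> t a a'
  proof -
    define S where "S = {(i, l). i < l \<and> l \<le> n \<and> \<not> (i = a \<and> l = a')}"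
    have "S \<subseteq> {..n} \<times> {..n}"
      by (auto simp: S_def)
    then have "finite S"
      by (rule finite_subset) auto
    moreover have "\<forall>\<^sub>F k in sequentially. \<delta> k < (pos k j (snd x) + \<tau> k *\<^sub>R vel k j (snd x)
        - (pos k j (fst x) + \<tau> k *\<^sub>R vel k j (fst x))) \<bullet> b" if x: "x \<in> S" for x
    proof -
      obtain i l where il: "x = (i, l)" "i < l" "l \<le> n" "\<not> (i = a \<and> l = a')"
        using x by (auto simp: S_def)
      have "(\<lambda>k. (pos k j l + \<tau> k *\<^sub>R vel k j l - (pos k j i + \<tau> k *\<^sub>R vel k j i)) \<bullet> b - \<delta> k)
          \<longlonglongrightarrow> ((offset j l + t * slope j l) *\<^sub>R b - (offset j i + t * slope j i) *\<^sub>R b) \<bullet> b - 0"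
        using il j by (intro tendsto_diff tendsto_inner lim_at \<tau> lim_\<delta> tendsto_const) auto
      moreover have "0 < ((offset j l + t * slope j l) *\<^sub>R b - (offset j i + t * slope j i) *\<^sub>R b) \<bullet> b - 0"
        using less[OF il(2-4)] by (simp add: inner_diff_left bb)
      ultimately have "\<forall>\<^sub>F k in sequentially.
          0 < (pos k j l + \<tau> k *\<^sub>R vel k j l - (pos k j i + \<tau> k *\<^sub>R vel k j i)) \<bullet> b - \<delta> k"
        by (rule order_tendstoD(1))
      then show ?thesis
        by eventually_elim (simp add: il(1))
    qed
    ultimately have "\<forall>\<^sub>F k in sequentially. \<forall>x\<in>S. \<delta> k < (pos k j (snd x) + \<tau> k *\<^sub>R vel k j (snd x)
        - (pos k j (fst x) + \<tau> k *\<^sub>R vel k j (fst x))) \<bullet> b"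
      by (intro eventually_ball_finite) auto
    then show ?thesis
      by eventually_elim (force simp: S_def)
  qed
  have speed: "\<forall>\<^sub>F k in sequentially. \<forall>i\<le>n. norm (vel k j i) \<le> W" if j: "j \<le> n" for j
  proof -
    have "\<forall>\<^sub>F k in sequentially. norm (vel k j i) \<le> W" if i: "i \<in> {..n}" for i
    proof -
      have "norm (slope j i *\<^sub>R b) < W"
        using W i j by (auto simp: slope_def b)
      then have "\<forall>\<^sub>F k in sequentially. norm (vel k j i) < W"
        using order_tendstoD(2)[OF tendsto_norm[OF lim_vel]] i j by auto
      then show ?thesis
        by eventually_elim simp
    qed
    then have "\<forall>\<^sub>F k in sequentially. \<forall>i\<in>{..n}. norm (vel k j i) \<le> W"
      by (intro eventually_ball_finite) auto
    then show ?thesis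
      by eventually_elim simp
  qed
  have reach: "\<forall>\<^sub>F k in sequentially. reach (\<delta> k) (Suc n) (N + j) W (\<mu> j) (pos k j) (vel k j)" if "j \<le> n" for j
    using that
  proof (induction j)
    case 0
    \<comment> \<open>The excepted pair (0, 0) is vacuous because of \<open>i < l\<close>: at the
      start all pairs are separated.\<close>
    have sl: "\<forall>\<^sub>F k in sequentially. \<forall>i l. i < l \<longrightarrow> l < Suc n \<longrightarrow> \<not> (i = 0 \<and> l = 0) \<longrightarrow>
        \<delta> k < (pos k 0 l + 0 *\<^sub>R vel k 0 l - (pos k 0 i + 0 *\<^sub>R vel k 0 i)) \<bullet> b"
    proof (rule sep[OF le0 tendsto_const])
      show "offset 0 i + 0 * slope 0 i < offset 0 l + 0 * slope 0 l" if "i < l" "l \<le> n" for i l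
        by (rule order_at[OF that]) (use n s_less_Suc[of 0] in \<open>auto simp: s_0\<close>)
    qed
    have "(\<lambda>k. vel k 0 0 \<bullet> b) \<longlonglongrightarrow> slope 0 0 *\<^sub>R b \<bullet> b"
      by (intro tendsto_inner lim_vel tendsto_const) auto
    then have "\<forall>\<^sub>F k in sequentially. W0 < vel k 0 0 \<bullet> b"
      using W0 by (intro order_tendstoD(1)) (auto simp: slope_def bb)
    then show ?case
      using R sl speed[OF le0]
    proof eventually_elim
      case (elim k)
      have "reach (\<delta> k) (Suc n) N W 0 (case_nat (C k 0) (\<lambda>i. P k (Suc i))) (case_nat (F k 0) (\<lambda>i. V k (Suc i)))"
      proof (rule reach_insert[OF _ b])
        show "reach (\<delta> k) n N W0 0 (\<lambda>i. P k (Suc i)) (\<lambda>i. V k (Suc i))"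
          using elim(2) by simp
        show "\<delta> k < (P k (Suc i) - C k 0) \<bullet> b" if "i < n" for i
          using elim(3)[rule_format, of 0 "Suc i"] that by (simp add: pos_def \<sigma>_0)
        show "W0 \<le> F k 0 \<bullet> b" "norm (F k 0) \<le> W"
          using elim(1) elim(4)[rule_format, of 0] by (simp_all add: vel_def)
      qed (use W0 W(1) in simp)
      moreover have "case_nat (C k 0) (\<lambda>i. P k (Suc i)) = pos k 0"
        by (rule ext) (simp add: pos_def \<sigma>_0 split: nat.split)
      moreover have "case_nat (F k 0) (\<lambda>i. V k (Suc i)) = vel k 0"
        by (rule ext) (simp add: vel_def split: nat.split)
      ultimately show ?case
        by (simp add: \<mu>_def)
    qed
  next
    case (Suc j)
    then have j: "j \<le> n" "j < n" "1 \<le> Suc j" "Suc j \<le> n" by auto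
    note \<sigma> = lim_\<sigma>[OF j(4)]
    have "U - A (Suc j) > 0"
      using A_less_U j by simp
    then have l_pos: "\<forall>\<^sub>F k in sequentially. 0 < l k (Suc j)"
      by (rule order_tendstoD(1)[OF lim_l[OF j(3,4)]])
    have \<mu>\<sigma>: "\<forall>\<^sub>F k in sequentially. \<mu> j < \<sigma> k (Suc j)" "\<forall>\<^sub>F k in sequentially. \<sigma> k (Suc j) < \<mu> (Suc j)"
      using order_tendstoD[OF \<sigma>] \<mu>2[OF j(1,2)] \<mu>1(2)[OF j(4)] by auto
    have sep1: "\<forall>\<^sub>F k in sequentially. \<forall>i l. i < l \<longrightarrow> l < Suc n \<longrightarrow> \<not> (i = j \<and> l = Suc j) \<longrightarrow>
        \<delta> k < (pos k j l + \<mu> j *\<^sub>R vel k j l - (pos k j i + \<mu> j *\<^sub>R vel k j i)) \<bullet> b"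
      using \<mu>1[OF j(1)] \<mu>2[OF j(1,2)] j by (intro sep[OF j(1) tendsto_const] order_at) auto
    have sep2: "\<forall>\<^sub>F k in sequentially. \<forall>i l. i < l \<longrightarrow> l < Suc n \<longrightarrow> \<not> (i = j \<and> l = Suc j) \<longrightarrow>
        \<delta> k < (pos k j l + \<sigma> k (Suc j) *\<^sub>R vel k j l - (pos k j i + \<sigma> k (Suc j) *\<^sub>R vel k j i)) \<bullet> b"
      using s_less_Suc[OF j(2)] j by (intro sep[OF j(1) \<sigma>] order_at) auto
    have sep3: "\<forall>\<^sub>F k in sequentially. \<forall>i l. i < l \<longrightarrow> l < Suc n \<longrightarrow> \<not> (i = j \<and> l = Suc j) \<longrightarrow>
        \<delta> k < (pos k (Suc j) l + \<sigma> k (Suc j) *\<^sub>R vel k (Suc j) l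
          - (pos k (Suc j) i + \<sigma> k (Suc j) *\<^sub>R vel k (Suc j) i)) \<bullet> b"
      using s_less_Suc[of "Suc j"] j by (intro sep[OF j(4) \<sigma>] order_at) auto
    have sep4: "\<forall>\<^sub>F k in sequentially. \<forall>i l. i < l \<longrightarrow> l < Suc n \<longrightarrow> \<not> (i = j \<and> l = Suc j) \<longrightarrow>
        \<delta> k < (pos k (Suc j) l + \<mu> (Suc j) *\<^sub>R vel k (Suc j) l
          - (pos k (Suc j) i + \<mu> (Suc j) *\<^sub>R vel k (Suc j) i)) \<bullet> b"
      using \<mu>1[OF j(4)] \<mu>2[OF j(4)] j by (intro sep[OF j(4) tendsto_const] order_at) auto
    show ?case
      using Suc.IH[OF j(1)] R l_pos \<mu>\<sigma> norm_e[OF j(3,4)] rel1[OF j(2)] rel2[OF j(2)]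
        sep1 sep2 sep3 sep4 speed[OF j(4)]
    proof eventually_elim
      case (elim k)
      \<comment> \<open>The minus sign is due to the orientation: \<open>e k (Suc j)\<close> points
        forwards from ball \<open>j\<close>, whereas the collision rule uses the centre of ball
        \<open>j\<close> minus that of ball \<open>j + 1\<close>.\<close>
      define w where "w = - (\<delta> k *\<^sub>R e k (Suc j))"
      have \<delta>: "0 < \<delta> k"
        using elim(2) by simp
      have nw: "norm w = \<delta> k"
        using \<delta> elim(6) by (simp add: w_def)
      have proj: "proj w (F k j - V k (Suc j)) = l k (Suc j) *\<^sub>R e k (Suc j)"
        unfolding proj_def nw using \<delta> elim(7) by (simp add: w_def power2_eq_square)
      have proj': "proj w (V k (Suc j) - F k j) = - (l k (Suc j) *\<^sub>R e k (Suc j))"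
        using proj_minus[of w "F k j - V k (Suc j)"] proj by simp
      have "reach (\<delta> k) (Suc n) (Suc (N + j)) W (\<mu> (Suc j)) (pos k (Suc j)) (vel k (Suc j))"
      proof (rule reach_collide[OF elim(1) elim(4,5), of j "Suc j" w])
        show "w = pos k j j + \<sigma> k (Suc j) *\<^sub>R vel k j j
            - (pos k j (Suc j) + \<sigma> k (Suc j) *\<^sub>R vel k j (Suc j))"
          using elim(8) C[OF j(3), of k] by (simp add: w_def pos_def vel_def algebra_simps)
        show "(vel k j j - vel k j (Suc j)) \<bullet> w < 0"
          using \<delta> elim(3,7) by (simp add: w_def vel_def)
        show "vel k (Suc j) i = collide w j (Suc j) (vel k j) i" if "i < Suc n" for i
          using proj proj' F[OF j(3), of k] by (auto simp: collide_def vel_def)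
        show "pos k (Suc j) i + \<sigma> k (Suc j) *\<^sub>R vel k (Suc j) i = pos k j i + \<sigma> k (Suc j) *\<^sub>R vel k j i"
          if "i < Suc n" for i
        proof -
          consider "i < j" | "i = j" | "i = Suc j" | "Suc j < i" by linarith
          then show ?thesis
          proof cases
            case 2
            then show ?thesis
              using elim(8) by (simp add: pos_def vel_def algebra_simps)
          next
            case 3
            then show ?thesis
              using C[OF j(3), of k] by (simp add: pos_def vel_def)
          qed (simp_all add: pos_def vel_def)
        qed
        show "norm (vel k (Suc j) i) \<le> W" if "i < Suc n" for i
          using elim(13) that by simp
        show "apart_except (\<delta> k) (Suc n) j (Suc j) (\<lambda>i. pos k j i + t *\<^sub>R vel k j i)"
          if "\<mu> j \<le> t" "t \<le> \<sigma> k (Suc j)" for t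
          by (rule apart_except_segment[OF b that]) (use elim(9,10) in auto)
        show "apart_except (\<delta> k) (Suc n) j (Suc j) (\<lambda>i. pos k (Suc j) i + t *\<^sub>R vel k (Suc j) i)"
          if "\<sigma> k (Suc j) \<le> t" "t \<le> \<mu> (Suc j)" for t
          by (rule apart_except_segment[OF b that]) (use elim(11,12) in auto)
      qed (use \<delta> nw j in auto)
      then show ?case by simp
    qed
  qed
  have \<mu>n: "\<mu> n = s n + 1"
    using n by (simp add: \<mu>_def)
  \<comment> \<open>The clock is reset, so that the result has the form in which the next relay
    takes it up.\<close>
  have "\<forall>\<^sub>F k in sequentially. reach (\<delta> k) (Suc n) (N + n) W 0 (\<lambda>i. pos k n i + (s n + 1) *\<^sub>R vel k n i) (vel k n)"
    using reach[OF order_refl]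
  proof eventually_elim
    case (elim k)
    show ?case
      using reach_shift[OF elim, of "s n + 1"] by (simp add: \<mu>n)
  qed
  then show ?thesis
    using lim_vel[OF _ order_refl] lim_at[OF _ order_refl tendsto_const]
    by (intro exI[of _ "\<lambda>k i. pos k n i + (s n + 1) *\<^sub>R vel k n i"] exI[of _ "\<lambda>k. vel k n"]) auto
qed

end

section \<open>Adding balls one at a time\<close>

text \<open>\<open>dispersed n N b\<close>: there are motions of balls of diameter tending to 0 that have had \<open>N\<close> collisions,
  have bounded speeds and converge to points moving apart on the line \<open>\<real>b\<close>.\<close>

definition dispersed :: "nat \<Rightarrow> nat \<Rightarrow> 'a::euclidean_space \<Rightarrow> bool" where
  "dispersed n N b \<longleftrightarrow> (\<exists>X A W \<delta> P V.
     (\<forall>i l. i < l \<longrightarrow> l < n \<longrightarrow> X i < X l \<and> A i < (A l :: real)) \<and> (\<forall>i<n. \<bar>A i\<bar> < W) \<and> \<delta> \<longlonglongrightarrow> 0 \<and>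
     (\<forall>i<n. (\<lambda>k. P k i) \<longlonglongrightarrow> X i *\<^sub>R b \<and> (\<lambda>k. V k i) \<longlonglongrightarrow> A i *\<^sub>R b) \<and>
     (\<forall>\<^sub>F k in sequentially. 0 < \<delta> k \<and> reach (\<delta> k) n N W 0 (P k) (V k)))"

text \<open>The relay meets the balls in their order along the line, and afterwards the speeds are
  the old ones followed by the new largest one, carried by the foremost ball. So the state is again
  dispersed.\<close>

lemma dispersed_Suc:
  fixes b :: "'a::euclidean_space"
  assumes b: "norm b = 1" and n: "1 \<le> n" and "dispersed n N b"
  shows "dispersed (Suc n) (N + n) b"
proof -
  obtain X A W \<delta> and P V :: "nat \<Rightarrow> nat \<Rightarrow> 'a" where
    asc: "\<forall>i l. i < l \<longrightarrow> l < n \<longrightarrow> X i < X l \<and> A i < (A l :: real)" and A: "\<forall>i<n. \<bar>A i\<bar> < W"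
    and \<delta>: "\<delta> \<longlonglongrightarrow> 0" and lim: "\<forall>i<n. (\<lambda>k. P k i) \<longlonglongrightarrow> X i *\<^sub>R b \<and> (\<lambda>k. V k i) \<longlonglongrightarrow> A i *\<^sub>R b"
    and R: "\<forall>\<^sub>F k in sequentially. 0 < \<delta> k \<and> reach (\<delta> k) n N W 0 (P k) (V k)"
    using assms(3) unfolding dispersed_def by (elim exE conjE)
  \<comment> \<open>\<open>W\<close> bounds all speeds of the past, not only the final ones, so
    \<open>U > W\<close> keeps the new ball clear of every earlier event. \<open>D\<close> makes the
    start \<open>- D\<close> lie behind the rearmost limiting point \<open>X 0\<close>.\<close>
  define U where "U = W + 1"
  define D where "D = \<bar>X 0\<bar> + 1"
  define s where "s i = (if i = 0 then 0 else (X (i - 1) + D) / (U - A (i - 1)))" for i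
  have UA: "0 < U - A i" if "i < n" for i
    using A that by (auto simp: U_def)
  have XD: "0 < X i + D" if "i < n" for i
  proof -
    have "X 0 \<le> X i"
      using asc that by (cases "i = 0") (auto simp: less_imp_le)
    then show ?thesis
      by (simp add: D_def)
  qed
  have s_less: "s i < s (Suc i)" if "i < n" for i
  proof (cases i)
    case 0
    then show ?thesis
      using XD[of 0] UA[of 0] that by (simp add: s_def)
  next
    case (Suc j)
    \<comment> \<open>A ball farther ahead is also faster: the gap to be closed grows and the
      closing speed shrinks, so it is met later.\<close>
    have "(X j + D) / (U - A j) < (X (Suc j) + D) / (U - A (Suc j))"
    proof (rule frac_less)
      have "X j < X (Suc j)" "A j < A (Suc j)"
        using asc[rule_format, of j "Suc j"] that Suc by simp_all
      then show "X j + D < X (Suc j) + D" "U - A (Suc j) \<le> U - A j"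
        by simp_all
    qed (use XD[of j] UA[of "Suc j"] that Suc in auto)
    then show ?thesis
      by (simp add: s_def Suc)
  qed
  \<comment> \<open>Relay index \<open>i\<close> is the old ball \<open>i - 1\<close>, which frees
    index 0 for the fast ball.\<close>
  interpret relay n b "\<lambda>i. X (i - 1)" "\<lambda>i. A (i - 1)" s U D \<delta> "\<lambda>k i. P k (i - 1)" "\<lambda>k i. V k (i - 1)"
  proof
    show "X (i - 1) + A (i - 1) * s i = U * s i - D" if "1 \<le> i" "i \<le> n" for i
    proof -
      have "(U - A (i - 1)) * s i = X (i - 1) + D"
        using UA[of "i - 1"] that by (force simp: s_def)
      then show ?thesis
        by (simp add: algebra_simps)
    qed
    show "X (i - 1) < X (l - 1)" "A (i - 1) < A (l - 1)" if "1 \<le> i" "i < l" "l \<le> n" for i l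
      using asc[rule_format, of "i - 1" "l - 1"] that by auto
    show "A (i - 1) < U" if "1 \<le> i" "i \<le> n" for i
      using UA[of "i - 1"] that by simp
    show "(\<lambda>k. P k (i - 1)) \<longlonglongrightarrow> X (i - 1) *\<^sub>R b" "(\<lambda>k. V k (i - 1)) \<longlonglongrightarrow> A (i - 1) *\<^sub>R b"
      if "1 \<le> i" "i \<le> n" for i
      using lim[rule_format, of "i - 1"] that by auto
  qed (use b \<delta> s_less in \<open>auto simp: s_def\<close>)
  have W: "0 < W"
    using A n by force
  obtain p v where pv: "\<forall>i\<le>n. (\<lambda>k. p k i) \<longlonglongrightarrow> (offset n i + (s n + 1) * slope n i) *\<^sub>R b \<and>
                     (\<lambda>k. v k i) \<longlonglongrightarrow> slope n i *\<^sub>R b"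
     "\<forall>\<^sub>F k in sequentially. reach (\<delta> k) (Suc n) (N + n) (W + 2) 0 (p k) (v k)"
  proof -
    have "\<forall>\<^sub>F k in sequentially. 0 < \<delta> k \<and> reach (\<delta> k) n N W 0 (\<lambda>i. P k (Suc i - 1)) (\<lambda>i. V k (Suc i - 1))"
      using R by simp
    note R' = this
    have "\<bar>A (i - 1)\<bar> < W + 2" if "1 \<le> i" "i \<le> n" for i
      using A[rule_format, of "i - 1"] that by fastforce
    moreover have "W < U" "U < W + 2" "0 \<le> U"
      using W by (simp_all add: U_def)
    ultimately show thesis
      using cascade[OF n R', of "W + 2"] that by blast
  qed
  have slope: "slope n i < slope n l" if "i < l" "l \<le> n" for i l
    unfolding slope_def using asc that UA[of i] by (cases "l = n") auto
  have off: "offset n i + (s n + 1) * slope n i < offset n l + (s n + 1) * slope n l" if "i < l" "l \<le> n" for i l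
    by (rule order_at) (use that in auto)
  have bound: "\<bar>slope n i\<bar> < W + 2" if "i < Suc n" for i
    unfolding slope_def using A[rule_format, of i] W that by (cases "i = n") (auto simp: U_def)
  show ?thesis
    unfolding dispersed_def
  proof (rule exI[of _ "\<lambda>i. offset n i + (s n + 1) * slope n i"], rule exI[of _ "slope n"],
      rule exI[of _ "W + 2"], rule exI[of _ \<delta>], rule exI[of _ p], rule exI[of _ v], intro conjI)
    show "\<forall>\<^sub>F k in sequentially. 0 < \<delta> k \<and> reach (\<delta> k) (Suc n) (N + n) (W + 2) 0 (p k) (v k)"
      using R pv(2) by eventually_elim simp
  qed (use slope off bound \<delta> pv(1) in \<open>simp_all add: less_Suc_eq_le\<close>)
qed

text \<open>For a suitable \<open>k\<close>, both the positions and the velocities along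
  \<open>b\<close> are strictly ordered with gaps in position exceeding the diameter. After scaling
  to diameter 2 the gaps only grow, so the motion continues freely for ever.\<close>

lemma evolution_of_dispersed:
  fixes b :: "'a::euclidean_space"
  assumes b: "norm b = 1" and "dispersed n N b"
  shows "\<exists>x :: nat \<Rightarrow> real \<Rightarrow> 'a. evolution n x \<and> enat N \<le> ecard (collisions n x)"
proof -
  obtain X A W \<delta> and P V :: "nat \<Rightarrow> nat \<Rightarrow> 'a" where
    asc: "\<forall>i l. i < l \<longrightarrow> l < n \<longrightarrow> X i < X l \<and> A i < (A l :: real)"
    and \<delta>: "\<delta> \<longlonglongrightarrow> 0" and lim: "\<forall>i<n. (\<lambda>k. P k i) \<longlonglongrightarrow> X i *\<^sub>R b \<and> (\<lambda>k. V k i) \<longlonglongrightarrow> A i *\<^sub>R b"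
    and R: "\<forall>\<^sub>F k in sequentially. 0 < \<delta> k \<and> reach (\<delta> k) n N W 0 (P k) (V k)"
    using assms(2) unfolding dispersed_def by (elim exE conjE)
  have bb: "b \<bullet> b = 1"
    using b by (simp add: norm_eq_1)
  define S where "S = {(i, l). i < l \<and> l < n}"
  have "S \<subseteq> {..n} \<times> {..n}"
    by (auto simp: S_def)
  then have "finite S"
    by (rule finite_subset) auto
  moreover have "\<forall>\<^sub>F k in sequentially. \<delta> k < (P k (snd z) - P k (fst z)) \<bullet> b
      \<and> 0 < (V k (snd z) - V k (fst z)) \<bullet> b" if z: "z \<in> S" for z
  proof -
    obtain i l where il: "z = (i, l)" "i < l" "l < n"
      using z by (auto simp: S_def)
    then have lims: "(\<lambda>k. P k i) \<longlonglongrightarrow> X i *\<^sub>R b" "(\<lambda>k. V k i) \<longlonglongrightarrow> A i *\<^sub>R b"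
      "(\<lambda>k. P k l) \<longlonglongrightarrow> X l *\<^sub>R b" "(\<lambda>k. V k l) \<longlonglongrightarrow> A l *\<^sub>R b"
      using lim by auto
    have "\<forall>\<^sub>F k in sequentially. 0 < (P k l - P k i) \<bullet> b - \<delta> k"
      by (rule order_tendstoD(1)[OF tendsto_diff[OF tendsto_inner[OF tendsto_diff[OF lims(3,1)] tendsto_const] \<delta>]])
         (use asc il in \<open>simp add: inner_diff_left bb\<close>)
    moreover have "\<forall>\<^sub>F k in sequentially. 0 < (V k l - V k i) \<bullet> b"
      by (rule order_tendstoD(1)[OF tendsto_inner[OF tendsto_diff[OF lims(4,2)] tendsto_const]])
         (use asc il in \<open>simp add: inner_diff_left bb\<close>)
    ultimately show ?thesis
      by eventually_elim (simp add: il(1))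
  qed
  ultimately have "\<forall>\<^sub>F k in sequentially. \<forall>z\<in>S. \<delta> k < (P k (snd z) - P k (fst z)) \<bullet> b
      \<and> 0 < (V k (snd z) - V k (fst z)) \<bullet> b"
    by (intro eventually_ball_finite) auto
  with R have "\<forall>\<^sub>F k in sequentially. (0 < \<delta> k \<and> reach (\<delta> k) n N W 0 (P k) (V k)) \<and>
      (\<forall>z\<in>S. \<delta> k < (P k (snd z) - P k (fst z)) \<bullet> b \<and> 0 < (V k (snd z) - V k (fst z)) \<bullet> b)"
    by (rule eventually_conj)
  then obtain k where k: "0 < \<delta> k" "reach (\<delta> k) n N W 0 (P k) (V k)"
    "\<forall>z\<in>S. \<delta> k < (P k (snd z) - P k (fst z)) \<bullet> b \<and> 0 < (V k (snd z) - V k (fst z)) \<bullet> b"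
    using eventually_happens'[OF sequentially_bot] by (metis (no_types, lifting))
  define c where "c = 2 / \<delta> k"
  have c: "0 < c" "c * \<delta> k = 2"
    using k(1) by (simp_all add: c_def)
  have reach: "reach 2 n N W 0 (\<lambda>i. c *\<^sub>R P k i) (V k)"
    using reach_scale[OF k(2) c(1)] c(2) by simp
  have "apart 2 n (\<lambda>i. c *\<^sub>R P k i + t *\<^sub>R V k i)" if t: "0 \<le> t" for t
  proof -
    have less: "2 < norm (c *\<^sub>R P k l + t *\<^sub>R V k l - (c *\<^sub>R P k i + t *\<^sub>R V k i))" if il: "i < l" "l < n" for i l
    proof -
      have "\<delta> k < (P k l - P k i) \<bullet> b" "0 < (V k l - V k i) \<bullet> b"
        using k(3) il by (auto simp: S_def)
      then have "c * \<delta> k < c * ((P k l - P k i) \<bullet> b) + t * ((V k l - V k i) \<bullet> b)"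
        using c(1) t by (intro less_le_trans[OF mult_strict_left_mono[of "\<delta> k"]]) auto
      also have "\<dots> = (c *\<^sub>R P k l + t *\<^sub>R V k l - (c *\<^sub>R P k i + t *\<^sub>R V k i)) \<bullet> b"
        by (simp add: inner_diff_left inner_add_left algebra_simps)
      also have "\<dots> \<le> norm (c *\<^sub>R P k l + t *\<^sub>R V k l - (c *\<^sub>R P k i + t *\<^sub>R V k i))"
        using norm_cauchy_schwarz[of _ b] b by (metis mult.right_neutral)
      finally show ?thesis
        using c(2) by simp
    qed
    show ?thesis
      unfolding apart_def
    proof (intro allI impI)
      fix i l assume "i < n" "l < n" "i \<noteq> l"
      then show "2 < norm (c *\<^sub>R P k i + t *\<^sub>R V k i - (c *\<^sub>R P k l + t *\<^sub>R V k l))"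
        using less[of i l] less[of l i] by (cases "i < l") (auto simp: norm_minus_commute)
    qed
  qed
  from reach_finish[OF reach this] obtain x :: "nat \<Rightarrow> real \<Rightarrow> 'a" and C where
    x: "\<forall>t. lawful 2 n x t" "finite C" "card C = N" "C \<subseteq> contact_times 2 n x"
    by blast
  interpret lawful_motion n x
    by unfold_locales (use x in blast)
  show ?thesis
    using evolution ecard_collisions[OF x(2,4)] x(3) by blast
qed

text \<open>At time \<open>r\<close> the motion is shrunk by the factor 1/r: the diameters become
  2/r and the positions p/r + v tend to \<open>v\<close>. Hence \<open>A\<close> serves both as
  limiting positions and as limiting speeds.\<close>

lemma dispersed_of_reach:
  fixes b :: "'a::euclidean_space"
  assumes R: "reach 2 n N W T p v" and ap: "\<And>t. T \<le> t \<Longrightarrow> apart 2 n (\<lambda>i. p i + t *\<^sub>R v i)"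
    and v: "\<And>i. i < n \<Longrightarrow> v i = A i *\<^sub>R b" and A: "\<And>i l. i < l \<Longrightarrow> l < n \<Longrightarrow> A i < A l"
    "\<And>i. i < n \<Longrightarrow> \<bar>A i\<bar> < W"
  shows "dispersed n N b"
proof -
  define r where "r k = \<bar>T\<bar> + real k + 1" for k
  have r: "0 < r k" "T \<le> r k" for k
    by (simp_all add: r_def)
  have lim_r: "filterlim r at_top sequentially"
    unfolding r_def add.assoc
    by (rule filterlim_tendsto_add_at_top[OF tendsto_const],
        rule filterlim_at_top_mono[OF filterlim_real_sequentially]) simp
  have inv: "(\<lambda>k. 1 / r k) \<longlonglongrightarrow> 0"
    using tendsto_inverse_0_at_top[OF lim_r] by (simp add: inverse_eq_divide)
  have reach: "reach (2 / r k) n N W 0 (\<lambda>i. (1 / r k) *\<^sub>R (p i + r k *\<^sub>R v i)) v" for k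
    using reach_scale[OF reach_shift[OF reach_wait[OF R r(2)[of k] ap], of "r k"], of "1 / r k"] r(1)[of k]
    by simp
  have \<delta>: "(\<lambda>k. 2 / r k) \<longlonglongrightarrow> 0"
    using tendsto_mult_right_zero[OF inv, of 2] by simp
  have P: "(\<lambda>k. (1 / r k) *\<^sub>R (p i + r k *\<^sub>R v i)) \<longlonglongrightarrow> A i *\<^sub>R b" if "i < n" for i
  proof -
    have "(\<lambda>k. (1 / r k) *\<^sub>R p i + v i) \<longlonglongrightarrow> 0 *\<^sub>R p i + v i"
      by (intro tendsto_intros inv)
    moreover have "(1 / r k) *\<^sub>R (p i + r k *\<^sub>R v i) = (1 / r k) *\<^sub>R p i + v i" for k
      using r(1)[of k] by (simp add: scaleR_right_distrib)
    ultimately show ?thesis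
      using v[OF that] by simp
  qed
  show ?thesis
    unfolding dispersed_def
    by (rule exI[of _ A], rule exI[of _ A], rule exI[of _ W], rule exI[of _ "\<lambda>k. 2 / r k"],
        rule exI[of _ "\<lambda>k i. (1 / r k) *\<^sub>R (p i + r k *\<^sub>R v i)"], rule exI[of _ "\<lambda>k. v"])
       (use A \<delta> P v r(1) reach in \<open>simp\<close>)
qed

lemma dispersed_from_3:
  fixes b :: "'a::euclidean_space"
  assumes b: "norm b = 1" and "dispersed 3 4 b" "3 \<le> n"
  shows "dispersed n (n * (n - 1) div 2 + 1) b"
  using assms(3)
proof (induction n rule: dec_induct)
  case base
  then show ?case
    using assms(2) by simp
next
  case (step n)
  have "n * (n - 1) div 2 + 1 + n = Suc n * (Suc n - 1) div 2 + 1"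
  proof (cases n)
    case (Suc m)
    have "(m * m + m + 2 * Suc m) div 2 = (m * m + m) div 2 + Suc m"
      by simp
    then show ?thesis
      by (simp add: Suc algebra_simps)
  qed simp
  then show ?case
    using dispersed_Suc[OF b _ step.IH] step.hyps by simp
qed

section \<open>Four collisions of three balls\<close>

definition triple :: "'b \<Rightarrow> 'b \<Rightarrow> 'b \<Rightarrow> nat \<Rightarrow> 'b" where
  "triple x y z i = (if i = 0 then x else if i = 1 then y else z)"

lemma triple_simps [simp]: "triple x y z 0 = x" "triple x y z (Suc 0) = y" "triple x y z 2 = z"
  by (simp_all add: triple_def)

lemma less_3: "(k :: nat) < 3 \<Longrightarrow> k = 0 \<or> k = Suc 0 \<or> k = 2"
  by linarith

lemma apart_except_01:
  assumes "\<delta> < norm (q 0 - q 2)" "\<delta> < norm (q 1 - q 2)"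
  shows "apart_except \<delta> 3 0 1 q"
  unfolding apart_except_def
proof (intro allI impI)
  fix k l :: nat assume "k < 3" "l < 3" "k \<noteq> l" "{k, l} \<noteq> {0, 1}"
  then show "\<delta> < norm (q k - q l)"
    using less_3[of k] less_3[of l] assms by (auto simp: norm_minus_commute)
qed

lemma apart_except_02:
  assumes "\<delta> < norm (q 0 - q 1)" "\<delta> < norm (q 1 - q 2)"
  shows "apart_except \<delta> 3 0 2 q"
  unfolding apart_except_def
proof (intro allI impI)
  fix k l :: nat assume "k < 3" "l < 3" "k \<noteq> l" "{k, l} \<noteq> {0, 2}"
  then show "\<delta> < norm (q k - q l)"
    using less_3[of k] less_3[of l] assms by (auto simp: norm_minus_commute)
qed

lemma apart_except_12:
  assumes "\<delta> < norm (q 0 - q 1)" "\<delta> < norm (q 0 - q 2)"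
  shows "apart_except \<delta> 3 1 2 q"
  unfolding apart_except_def
proof (intro allI impI)
  fix k l :: nat assume "k < 3" "l < 3" "k \<noteq> l" "{k, l} \<noteq> {1, 2}"
  then show "\<delta> < norm (q k - q l)"
    using less_3[of k] less_3[of l] assms by (auto simp: norm_minus_commute)
qed

section \<open>Exact data for three balls in a plane\<close>

locale plane =
  fixes b c :: "'a::euclidean_space"
  assumes b: "norm b = 1" and c: "norm c = 1" and bc: "b \<bullet> c = 0"
begin

definition pt :: "real \<Rightarrow> real \<Rightarrow> 'a" where
  "pt x y = x *\<^sub>R b + y *\<^sub>R c"

lemma inner_pt: "pt x y \<bullet> pt x' y' = x * x' + y * y'"
  using b c bc by (simp add: pt_def inner_add_left inner_add_right norm_eq_1 inner_commute[of c b])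

lemma norm_pt: "norm (pt x y) = sqrt (x * x + y * y)"
  by (simp add: norm_eq_sqrt_inner inner_pt)

lemma norm_pt_le_2: "norm (pt x y) \<le> 2 \<longleftrightarrow> x * x + y * y \<le> 4"
  using real_sqrt_le_iff[of "x * x + y * y" 4] by (simp add: norm_pt)

lemma norm_pt_eq_2: "norm (pt x y) = 2 \<longleftrightarrow> x * x + y * y = 4"
  using real_sqrt_eq_iff[of "x * x + y * y" 4] by (simp add: norm_pt)

lemma norm_pt_eq_1: "norm (pt x y) = 1 \<longleftrightarrow> x * x + y * y = 1"
  by (simp add: norm_pt)

lemma pt_zero [simp]: "pt 0 0 = 0"
  by (simp add: pt_def)

lemma pt_add: "pt x y + pt x' y' = pt (x + x') (y + y')"
  by (simp add: pt_def algebra_simps)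

lemma pt_diff: "pt x y - pt x' y' = pt (x - x') (y - y')"
  by (simp add: pt_def algebra_simps)

lemma pt_scale: "a *\<^sub>R pt x y = pt (a * x) (a * y)"
  by (simp add: pt_def algebra_simps)

lemma pt_proj: "proj (pt x y) (pt x' y')
    = pt ((x' * x + y' * y) / (x * x + y * y) * x) ((x' * x + y' * y) / (x * x + y * y) * y)"
  by (simp add: proj_def norm_pt inner_pt pt_scale)

text \<open>Positions and velocities of three balls in the order of time.  The numbers were found by computing
  backwards from the collinear velocities \<open>v4\<close>, with three rational directions of impact.\<close>

definition p1 :: "nat \<Rightarrow> 'a" where
  "p1 = triple (pt (- 5818928/1795625) (13941647/12569375))
     (pt (- 3514697/1795625) (- 784271/1795625))
     (pt (- 423/4225) (- 752/29575))"

definition v1 :: "nat \<Rightarrow> 'a" where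
  "v1 = triple (pt (- 18704/21125) (- 3417/21125))
     (pt (- 8799/84500) (7497/21125))
     (pt (- 3213/4225) (- 816/4225))"

definition p2 :: "nat \<Rightarrow> 'a" where
  "p2 = triple (pt (- 17951/5525) (43451/38675))
     (pt (- 139982/71825) (- 32399/71825))
     (pt (- 423/4225) (- 752/29575))"

definition v2 :: "nat \<Rightarrow> 'a" where
  "v2 = triple (pt (- 91/100) (- 3/25))
     (pt (- 336/4225) (1323/4225))
     (pt (- 3213/4225) (- 816/4225))"

definition p3 :: "nat \<Rightarrow> 'a" where
  "p3 = triple (pt (- 17951/5525) (43451/38675))
     (pt (- 11321/5525) (- 18429/38675))
     (pt 0 0)"

definition v3 :: "nat \<Rightarrow> 'a" where
  "v3 = triple (pt (- 91/100) (- 3/25))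
     (pt (- 21/25) (3/25))
     (pt 0 0)"

definition v4 :: "nat \<Rightarrow> 'a" where
  "v4 = triple (pt (- 1) 0)
     (pt (- 3/4) 0)
     (pt 0 0)"

lemmas core_simps = p1_def p2_def p3_def v1_def v2_def v3_def v4_def
  pt_add pt_diff pt_scale pt_proj inner_pt norm_pt_le_2 norm_pt_eq_2 norm_pt_eq_1

text \<open>The four collisions are those of the pairs 02, 01, 12 and 01; this is the second. The
  contact vectors in these steps are twice the unit vectors of the Pythagorean triples (33, 56, 65),
  (63, 16, 65) and (3, 4, 5), and the separating directions also come from such triples. Thus every
  check is rational arithmetic.\<close>

lemma core_step_1:
  assumes "reach 2 3 N 2 (- 4) p1 v1"
  shows "reach 2 3 (Suc N) 2 (- 1/5) p2 v2"
proof (rule reach_collide[OF assms, of "(- 12/35)" _ 0 1 "pt (- 66/65) (112/65)"])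
  show "apart_except 2 3 0 1 (\<lambda>i. p1 i + t *\<^sub>R v1 i)" if "(- 4) \<le> t" "t \<le> (- 12/35)" for t
  proof (rule apart_except_01)
    show "2 < norm (p1 0 + t *\<^sub>R v1 0 - (p1 2 + t *\<^sub>R v1 2))"
      by (rule segment_far[OF _ that, of "pt (- 35/37) (12/37)"]) (simp_all add: core_simps)
    show "2 < norm (p1 1 + t *\<^sub>R v1 1 - (p1 2 + t *\<^sub>R v1 2))"
      by (rule segment_far[OF _ that, of "pt (- 24/25) (- 7/25)"]) (simp_all add: core_simps)
  qed
  show "apart_except 2 3 0 1 (\<lambda>i. p2 i + t *\<^sub>R v2 i)" if "(- 12/35) \<le> t" "t \<le> (- 1/5)" for t
  proof (rule apart_except_01)
    show "2 < norm (p2 0 + t *\<^sub>R v2 0 - (p2 2 + t *\<^sub>R v2 2))"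
      by (rule segment_far[OF _ that, of "pt (- 35/37) (12/37)"]) (simp_all add: core_simps)
    show "2 < norm (p2 1 + t *\<^sub>R v2 1 - (p2 2 + t *\<^sub>R v2 2))"
      by (rule segment_far[OF _ that, of "pt (- 24/25) (- 7/25)"]) (simp_all add: core_simps)
  qed
  show "v2 k = collide (pt (- 66/65) (112/65)) 0 1 v1 k" if "k < 3" for k
    using less_3[OF that] by (auto simp: collide_def core_simps)
  show "p2 k + (- 12/35) *\<^sub>R v2 k = p1 k + (- 12/35) *\<^sub>R v1 k" "norm (v2 k) \<le> 2" if "k < 3" for k
    using less_3[OF that] by (auto simp: core_simps)
qed (simp_all add: core_simps)

lemma core_step_2:
  assumes "reach 2 3 N 2 (- 1/5) p2 v2"
  shows "reach 2 3 (Suc N) 2 (- 1/10) p3 v3"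
proof (rule reach_collide[OF assms, of "(- 47/357)" _ 1 2 "pt (- 126/65) (- 32/65)"])
  show "apart_except 2 3 1 2 (\<lambda>i. p2 i + t *\<^sub>R v2 i)" if "(- 1/5) \<le> t" "t \<le> (- 47/357)" for t
  proof (rule apart_except_12)
    show "2 < norm (p2 0 + t *\<^sub>R v2 0 - (p2 1 + t *\<^sub>R v2 1))"
      by (rule segment_far[OF _ that, of "pt (- 3/5) (4/5)"]) (simp_all add: core_simps)
    show "2 < norm (p2 0 + t *\<^sub>R v2 0 - (p2 2 + t *\<^sub>R v2 2))"
      by (rule segment_far[OF _ that, of "pt (- 35/37) (12/37)"]) (simp_all add: core_simps)
  qed
  show "apart_except 2 3 1 2 (\<lambda>i. p3 i + t *\<^sub>R v3 i)" if "(- 47/357) \<le> t" "t \<le> (- 1/10)" for t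
  proof (rule apart_except_12)
    show "2 < norm (p3 0 + t *\<^sub>R v3 0 - (p3 1 + t *\<^sub>R v3 1))"
      by (rule segment_far[OF _ that, of "pt (- 3/5) (4/5)"]) (simp_all add: core_simps)
    show "2 < norm (p3 0 + t *\<^sub>R v3 0 - (p3 2 + t *\<^sub>R v3 2))"
      by (rule segment_far[OF _ that, of "pt (- 35/37) (12/37)"]) (simp_all add: core_simps)
  qed
  show "v3 k = collide (pt (- 126/65) (- 32/65)) 1 2 v2 k" if "k < 3" for k
    using less_3[OF that] by (auto simp: collide_def core_simps)
  show "p3 k + (- 47/357) *\<^sub>R v3 k = p2 k + (- 47/357) *\<^sub>R v2 k" "norm (v3 k) \<le> 2" if "k < 3" for k
    using less_3[OF that] by (auto simp: core_simps)
qed (simp_all add: core_simps)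

text \<open>Positions are extrapolated to time 0 and this impact happens at time 0, so
  \<open>p3\<close> belongs to the lines before and after it.\<close>

lemma core_step_3:
  assumes "reach 2 3 N 2 (- 1/10) p3 v3"
  shows "reach 2 3 (Suc N) 2 1 p3 v4"
proof (rule reach_collide[OF assms, of "0" _ 0 1 "pt (- 6/5) (8/5)"])
  show "apart_except 2 3 0 1 (\<lambda>i. p3 i + t *\<^sub>R v3 i)" if "(- 1/10) \<le> t" "t \<le> 0" for t
  proof (rule apart_except_01)
    show "2 < norm (p3 0 + t *\<^sub>R v3 0 - (p3 2 + t *\<^sub>R v3 2))"
      by (rule segment_far[OF _ that, of "pt (- 35/37) (12/37)"]) (simp_all add: core_simps)
    show "2 < norm (p3 1 + t *\<^sub>R v3 1 - (p3 2 + t *\<^sub>R v3 2))"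
      by (rule segment_far[OF _ that, of "pt (- 24/25) (- 7/25)"]) (simp_all add: core_simps)
  qed
  show "apart_except 2 3 0 1 (\<lambda>i. p3 i + t *\<^sub>R v4 i)" if "0 \<le> t" "t \<le> 1" for t
  proof (rule apart_except_01)
    show "2 < norm (p3 0 + t *\<^sub>R v4 0 - (p3 2 + t *\<^sub>R v4 2))"
      by (rule segment_far[OF _ that, of "pt (- 35/37) (12/37)"]) (simp_all add: core_simps)
    show "2 < norm (p3 1 + t *\<^sub>R v4 1 - (p3 2 + t *\<^sub>R v4 2))"
      by (rule segment_far[OF _ that, of "pt (- 24/25) (- 7/25)"]) (simp_all add: core_simps)
  qed
  show "v4 k = collide (pt (- 6/5) (8/5)) 0 1 v3 k" if "k < 3" for k
    using less_3[OF that] by (auto simp: collide_def core_simps)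
  show "p3 k + 0 *\<^sub>R v4 k = p3 k + 0 *\<^sub>R v3 k" "norm (v4 k) \<le> 2" if "k < 3" for k
    using less_3[OF that] by (auto simp: core_simps)
qed (simp_all add: core_simps)

text \<open>Traced backwards, balls 0 and 2 are farther apart than 2 at time -5 and overlap or touch
  at time -16, so they are tangent in between.\<close>

lemma first_contact:
  "\<exists>s. -16 \<le> s \<and> s \<le> -5 \<and> norm (p1 0 + s *\<^sub>R v1 0 - (p1 2 + s *\<^sub>R v1 2)) = 2"
proof -
  have "norm (p1 0 + (-16) *\<^sub>R v1 0 - (p1 2 + (-16) *\<^sub>R v1 2)) \<le> 2"
    by (simp add: core_simps)
  moreover have "2 \<le> norm (p1 0 + (-5) *\<^sub>R v1 0 - (p1 2 + (-5) *\<^sub>R v1 2))"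
    by (rule less_imp_le, rule segment_far[of "pt (- 35/37) (12/37)" "-5" _ "-5"]) (simp_all add: core_simps)
  ultimately show ?thesis
    by (intro IVT') (auto intro!: continuous_intros)
qed

text \<open>The time of the first collision, and hence the velocities before it, are irrational; only a rough
  bound on these velocities is needed.\<close>

lemma core_start: "reach 2 3 1 2 (-4) p1 v1"
proof -
  obtain s where s: "-16 \<le> s" "s \<le> -5" "norm (p1 0 + s *\<^sub>R v1 0 - (p1 2 + s *\<^sub>R v1 2)) = 2"
    using first_contact by blast
  define w where "w = p1 0 + s *\<^sub>R v1 0 - (p1 2 + s *\<^sub>R v1 2)"
  \<comment> \<open>\<open>k *\<^sub>R w\<close> is the projection of the outgoing relative velocity
    on the contact vector, whose squared length is 4. Undoing the collision subtracts it from one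
    velocity and adds it to the other.\<close>
  define k where "k = (v1 0 - v1 2) \<bullet> w / 4"
  define u where "u = triple (v1 0 - k *\<^sub>R w) (v1 1) (v1 2 + k *\<^sub>R w)"
  define p where "p = triple (p1 0 + (s * k) *\<^sub>R w) (p1 1) (p1 2 - (s * k) *\<^sub>R w)"
  \<comment> \<open>A direction along which balls 0 and 2 both lie beyond ball 1, whatever the exact
    time \<open>s\<close> is.\<close>
  define z where "z = pt (3/5) (4/5)"
  have w: "norm w = 2" "w \<bullet> w = 4"
    using s(3) by (simp_all add: w_def norm_eq_square)
  have k: "0 < k"
    unfolding k_def w_def using s(1) by (simp add: core_simps algebra_simps)
  have kw: "norm (k *\<^sub>R w) \<le> 1 / 5"
  proof -
    have "\<bar>(v1 0 - v1 2) \<bullet> w\<bar> \<le> norm (v1 0 - v1 2) * 2"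
      using Cauchy_Schwarz_ineq2[of "v1 0 - v1 2" w] w by simp
    moreover have "norm (v1 0 - v1 2) \<le> 1 / 5"
      by (rule power2_le_imp_le) (simp_all add: power2_norm_eq_inner core_simps, simp add: power2_eq_square)
    ultimately show ?thesis
      using k w by (simp add: k_def)
  qed
  have z: "norm z = 1"
    by (simp add: z_def core_simps)
  have kz: "\<bar>(k *\<^sub>R w) \<bullet> z\<bar> \<le> 1 / 5"
    using Cauchy_Schwarz_ineq2[of "k *\<^sub>R w" z] kw z by simp
  have pu: "p i + t *\<^sub>R u i = p1 i + s *\<^sub>R v1 i + (t - s) *\<^sub>R u i" if "i < 3" for i t
    using less_3[OF that] by (auto simp: p_def u_def algebra_simps)
  \<comment> \<open>Undoing the collision changes components along \<open>z\<close> by at most 1/5,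
    and the known relative components are at most -1/5. The sign is preserved, so ball 1 was even
    farther away in the past.\<close>
  have dir01: "(u 0 - u 1) \<bullet> z \<le> 0" "(u 2 - u 1) \<bullet> z \<le> 0"
  proof -
    have "(v1 0 - v1 1) \<bullet> z \<le> - (1 / 5)" "(v1 2 - v1 1) \<bullet> z \<le> - (1 / 5)"
      by (simp_all add: z_def core_simps)
    moreover have "(u 0 - u 1) \<bullet> z = (v1 0 - v1 1) \<bullet> z - (k *\<^sub>R w) \<bullet> z"
      "(u 2 - u 1) \<bullet> z = (v1 2 - v1 1) \<bullet> z + (k *\<^sub>R w) \<bullet> z"
      by (simp_all add: u_def inner_diff_left inner_add_left)
    ultimately show "(u 0 - u 1) \<bullet> z \<le> 0" "(u 2 - u 1) \<bullet> z \<le> 0"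
      using kz by linarith+
  qed
  have at_s: "2 < (p1 i + s *\<^sub>R v1 i - (p1 1 + s *\<^sub>R v1 1)) \<bullet> z"
      "2 < (p1 i + (-4) *\<^sub>R v1 i - (p1 1 + (-4) *\<^sub>R v1 1)) \<bullet> z" if "i \<in> {0, 2}" for i
    using that s(2) by (auto simp: z_def core_simps algebra_simps)
  have far: "2 < norm (p i + t *\<^sub>R u i - (p 1 + t *\<^sub>R u 1))" if i: "i \<in> {0, 2}" and t: "t \<le> s" for i t
  proof -
    have "(u i - u 1) \<bullet> z \<le> 0"
      using i dir01 by auto
    then have "0 \<le> (t - s) * ((u i - u 1) \<bullet> z)"
      using t by (intro mult_nonpos_nonpos) auto
    moreover have "(p i + t *\<^sub>R u i - (p 1 + t *\<^sub>R u 1)) \<bullet> z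
        = (p1 i + s *\<^sub>R v1 i - (p1 1 + s *\<^sub>R v1 1)) \<bullet> z + (t - s) * ((u i - u 1) \<bullet> z)"
    proof -
      have "i < 3" "(1::nat) < 3"
        using i by auto
      then have "p i + t *\<^sub>R u i - (p 1 + t *\<^sub>R u 1)
          = p1 i + s *\<^sub>R v1 i - (p1 1 + s *\<^sub>R v1 1) + (t - s) *\<^sub>R (u i - u 1)"
        by (simp only: pu) (simp add: algebra_simps)
      then show ?thesis
        by (simp only: inner_add_left inner_scaleR_left)
    qed
    ultimately have "2 < (p i + t *\<^sub>R u i - (p 1 + t *\<^sub>R u 1)) \<bullet> z"
      using at_s(1)[OF i] by linarith
    also have "\<dots> \<le> norm (p i + t *\<^sub>R u i - (p 1 + t *\<^sub>R u 1))"
      using norm_cauchy_schwarz[of "p i + t *\<^sub>R u i - (p 1 + t *\<^sub>R u 1)" z] z by simp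
    finally show ?thesis .
  qed
  have before: "apart_except 2 3 0 2 (\<lambda>i. p i + t *\<^sub>R u i)" if "t \<le> s" for t
    using far[of 0 t] far[of 2 t] that by (intro apart_except_02) (auto simp: norm_minus_commute)
  have u02: "(u 0 - u 2) \<bullet> w = - (4 * k)"
  proof -
    have "(u 0 - u 2) \<bullet> w = (v1 0 - v1 2) \<bullet> w - (k * (w \<bullet> w) + k * (w \<bullet> w))"
      by (simp add: u_def inner_diff_left inner_add_left)
    also have "(v1 0 - v1 2) \<bullet> w = 4 * k"
      by (simp add: k_def)
    finally show ?thesis
      using w(2) by simp
  qed
  have "apart 2 3 (\<lambda>i. p i + t *\<^sub>R u i)" if t: "t \<le> s - 1" for t
  proof (rule apart_exceptD[OF before])
    have "p 0 + t *\<^sub>R u 0 - (p 2 + t *\<^sub>R u 2) = w + (t - s) *\<^sub>R (u 0 - u 2)"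
      by (simp add: pu w_def algebra_simps)
    then show "2 < norm (p 0 + t *\<^sub>R u 0 - (p 2 + t *\<^sub>R u 2))"
      using norm_approach_strict[of w "u 0 - u 2" "t - s"] u02 k w t by (simp add: inner_commute)
  qed (use t in simp)
  moreover have "norm (u i) \<le> 2" if "i < 3" for i
  proof -
    have v: "norm (v1 0) \<le> 1" "norm (v1 2) \<le> 1" "norm (v1 1) \<le> 1"
      by (simp_all add: core_simps norm_pt)
    have "norm (v1 0 - k *\<^sub>R w) \<le> 2" "norm (v1 2 + k *\<^sub>R w) \<le> 2"
      using norm_triangle_ineq4[of "v1 0" "k *\<^sub>R w"] norm_triangle_ineq[of "v1 2" "k *\<^sub>R w"] v kw by linarith+
    then show ?thesis
      using less_3[OF that] v by (auto simp: u_def)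
  qed
  ultimately have start: "reach 2 3 0 2 (s - 1) p u"
    by (rule reach_start)
  have pr: "proj w (u 0 - u 2) = - (k *\<^sub>R w)" "proj w (u 2 - u 0) = k *\<^sub>R w"
    using u02 w proj_minus[of w "u 0 - u 2"] by (simp_all add: proj_def)
  have "reach 2 3 (Suc 0) 2 (-4) p1 v1"
  proof (rule reach_collide[OF start, of s _ 0 2 w])
    show "w = p 0 + s *\<^sub>R u 0 - (p 2 + s *\<^sub>R u 2)"
      by (simp add: pu w_def)
    show "v1 i = collide w 0 2 u i" if "i < 3" for i
      using less_3[OF that] pr by (auto simp: collide_def) (auto simp: u_def)
    show "p1 i + s *\<^sub>R v1 i = p i + s *\<^sub>R u i" "norm (v1 i) \<le> 2" if "i < 3" for i
      using less_3[OF that] by (auto simp: pu) (auto simp: core_simps)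
    show "apart_except 2 3 0 2 (\<lambda>i. p1 i + t *\<^sub>R v1 i)" if "s \<le> t" "t \<le> -4" for t
      using segment_far[OF z that at_s[of 0]] segment_far[OF z that at_s[of 2]]
      by (intro apart_except_02) (auto simp: norm_minus_commute)
  qed (use s u02 k w before in auto)
  then show ?thesis by simp
qed

lemma dispersed_core: "dispersed 3 4 b"
proof (rule dispersed_of_reach)
  show "reach 2 3 4 2 1 p3 v4"
    using core_step_3[OF core_step_2[OF core_step_1[OF core_start]]] by (simp add: eval_nat_numeral)
  show "apart 2 3 (\<lambda>i. p3 i + t *\<^sub>R v4 i)" if "1 \<le> t" for t
  proof (rule apart_exceptD)
    show "apart_except 2 3 0 1 (\<lambda>i. p3 i + t *\<^sub>R v4 i)"
    proof (rule apart_except_01)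
      show "2 < norm (p3 0 + t *\<^sub>R v4 0 - (p3 2 + t *\<^sub>R v4 2))"
        \<comment> \<open>The moment \<open>t\<close> itself is the right end of the segment: the
          gap along the direction is affine and does not decrease, which covers all later
          times.\<close>
        by (rule segment_far[OF _ that order_refl, of "pt (- 35/37) (12/37)"])
           (use that in \<open>simp_all add: core_simps algebra_simps\<close>)
      show "2 < norm (p3 1 + t *\<^sub>R v4 1 - (p3 2 + t *\<^sub>R v4 2))"
        by (rule segment_far[OF _ that order_refl, of "pt (- 24/25) (- 7/25)"])
           (use that in \<open>simp_all add: core_simps algebra_simps\<close>)
    qed
    show "2 < norm (p3 0 + t *\<^sub>R v4 0 - (p3 1 + t *\<^sub>R v4 1))"
      by (rule segment_far[OF _ that order_refl, of "pt (- 3/5) (4/5)"])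
         (use that in \<open>simp_all add: core_simps algebra_simps\<close>)
  qed
  show "v4 i = triple (-1) (- 3/4) 0 i *\<^sub>R b" if "i < 3" for i
    using less_3[OF that] by (auto simp: v4_def pt_def)
  show "triple (-1) (- 3/4) 0 i < (triple (-1) (- 3/4) 0 l :: real)" if "i < l" "l < 3" for i l
    using less_3[of i] less_3[of l] that by auto
  show "\<bar>triple (-1) (- 3/4) 0 i :: real\<bar> < 2" if "i < 3" for i
    using less_3[OF that] by auto
qed

end

theorem corollary1p3:
  fixes n :: nat
  assumes "n \<ge> 3" and "CARD('d::finite) \<ge> 2"
  shows "K n TYPE('d) > enat (n * (n - 1) div 2)"
proof -
  have "\<not> card (UNIV :: 'd set) \<le> Suc 0"
    using assms(2) by simp
  then obtain i j :: 'd where ij: "i \<noteq> j"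
    by (auto simp: card_le_Suc0_iff_eq)
  interpret plane "axis i 1 :: real ^ 'd" "axis j 1"
    using ij by unfold_locales (simp_all add: inner_axis_axis)
  obtain x :: "nat \<Rightarrow> real \<Rightarrow> real ^ 'd" where x: "evolution n x"
      "enat (n * (n - 1) div 2 + 1) \<le> ecard (collisions n x)"
    using evolution_of_dispersed[OF b dispersed_from_3[OF b dispersed_core assms(1)]] by blast
  have "enat (n * (n - 1) div 2) < enat (n * (n - 1) div 2 + 1)"
    by simp
  also have "\<dots> \<le> ecard (collisions n x)"
    by (rule x(2))
  also have "\<dots> \<le> K n TYPE('d)"
    unfolding K_def using x(1) by (intro SUP_upper) simp
  finally show ?thesis .
qed

end
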